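(* Let $G$ be a weakly connected oriented graph on $n\ge 2$ vertices $1,\dots,n$ with $m\ge 1$ edges $e_1,\dots,e_m$, with non-zero edge weights in $\mathbb{C}\setminus\mathbb{R}^-$ and complex signless Laplacian matrix $Q$. Suppose that $G$ contains cycles, that $wt(C)\in\mathbb{R}^-$ for all odd cycles $C$ of $G$ and that $wt(C)\in\mathbb{R}^+$ for all even cycles $C$ of $G$. Then the Moore--Penrose inverse $Q^+$ of $Q$ has entries $$(Q^+)_{ij}=\left[\frac{1}{\sum_{T\in\mathcal{T}(G)}|W_T|}\right]^2\sum_{k=1}^m\ \sum_{\substack{T_r,T_s\in\mathcal{T}(G)\\ e_k\in T_r\cap T_s}}|W_{T_r}||W_{T_s}|\,\overline{(N^+_{T_r})_{ki}}\,(N^+_{T_s})_{kj},$$ where $\mathcal{T}(G)$ is the set of all oriented spanning trees of $G$ and, for $T\in\mathcal{T}(G)$ and $e_k=(u,v)\in T$, $$(N_T^+)_{kj}=\frac{(-1)^{d(e_k,j)}}{n}\begin{cases}\dfrac{|T_h(e_k)|}{\sqrt{w_{uv}}}\,\dfrac{|wt(\gamma_{j\to u})|}{wt(\gamma_{j\to u})} & \text{if } j\in T_t(e_k),\\[2mm] \dfrac{|T_t(e_k)|}{\sqrt{\overline{w_{uv}}}}\,\dfrac{|wt(\gamma_{j\to v})|}{wt(\gamma_{j\to v})} & \text{if } j\in T_h(e_k).\end{cases}$$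
   Context: An oriented graph $G$ is obtained from a finite simple undirected graph $G_u$ (its underlying graph) by giving each edge exactly one direction; it is weakly connected if $G_u$ is connected. Write $V(G)=\{1,\dots,n\}$ and $E(G)=\{e_1,\dots,e_m\}$. Each directed edge $(u,v)$ (tail $u$, head $v$) has a non-zero complex weight $w_{uv}$. $\mathbb{R}^+$ and $\mathbb{R}^-$ denote the positive and the negative real numbers, and $\sqrt{\cdot}$ is the principal square root. The complex adjacency matrix is $A=(a_{ij})$ with $a_{ij}=w_{ij}$ if $(i,j)\in E(G)$, $a_{ij}=\overline{w_{ji}}$ if $(j,i)\in E(G)$, and $a_{ij}=0$ otherwise. The complex signless Laplacian matrix is $Q=D+A$, where $D$ is diagonal with $D_{ii}=\sum_{j\ne i}|a_{ij}|$. One has $Q=NN^*$, where $N=(n_{ij})$ is the $n\times m$ complex signless incidence matrix: for $e_j=(u,v)$, $n_{ij}=\sqrt{w_{uv}}$ if $i=u$, $n_{ij}=\sqrt{\overline{w_{uv}}}$ if $i=v$, and $n_{ij}=0$ otherwise. The weight of a walk $\gamma=(i_1,\dots,i_k)$ in $G_u$ is $wt(\gamma)=\prod_{s=1}^{k-1}a_{i_si_{s+1}}$ (so a trivial one-vertex walk has weight $1$). A cycle of $G$ means a cycle of $G_u$; $wt(C)$ is the weight of the closed walk going once around $C$ in either direction (the two directions give complex conjugate values, so the conditions $wt(C)\in\mathbb{R}^\pm$ do not depend on the choice). For an oriented graph $H$, $W_H$ is the product of all edge weights of $H$. For a spanning tree $T$ and an edge $e_k=(u,v)$ of $T$: $T_t(e_k)$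 and $T_h(e_k)$ are the connected components of $T-e_k$ containing the tail $u$ and the head $v$, respectively, and $|T_t(e_k)|,|T_h(e_k)|$ are their numbers of vertices; $d(e_k,j)=\min(d(u,j),d(v,j))$ with $d$ the distance in $T$; $\gamma_{j\to u}$ is the unique walk without repeated vertices from $j$ to $u$ in $T$. Here $N_T$ is the complex signless incidence matrix of $T$, and the rows of its Moore--Penrose inverse $N_T^+$ are labelled by the edges of $T$ (keeping the labels from $G$) and its columns by the vertices. *)

theory Defs
  imports Complex_Main "Graph_Theory.Graph_Theory"
begin

section \<open>Oriented graphs, their cycles and spanning trees\<close>

locale oriented_graph = digraph +
  assumes no_opposite_arcs: "(u, v) \<in> arcs_ends G \<Longrightarrow> (v, u) \<notin> arcs_ends G"

definition underlying :: "('a, 'b) pre_digraph \<Rightarrow> ('a, 'a \<times> 'a) pre_digraph" where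
  "underlying G = with_proj (mk_symmetric G)"

text \<open>
  A cycle of the underlying simple graph, as a closed vertex walk that repeats its start vertex at
  the end. At least three edges are required because \<^const>\<open>underlying\<close> is a symmetric digraph, in
  which going back and forth along one edge is also a closed walk. The number of edges of the cycle
  is \<^const>\<open>vwalk_length\<close>.
\<close>

definition is_cycle :: "('a, 'b) pre_digraph \<Rightarrow> 'a vwalk \<Rightarrow> bool" where
  "is_cycle G c \<longleftrightarrow>
     vwalk c (underlying G) \<and> hd c = last c \<and> distinct (tl c) \<and> vwalk_length c \<ge> 3"

text \<open>
  The constants \<^const>\<open>forest\<close>, \<^const>\<open>tree\<close> and \<^const>\<open>spanning_tree\<close> of the library only exclude
  directed cycles, so they do not describe trees of the underlying undirected graph.
\<close>

definition spanning_trees :: "('a, 'b) pre_digraph \<Rightarrow> ('a, 'b) pre_digraph set" where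
  "spanning_trees G = {T. spanning T G \<and> connected T \<and> \<not> (\<exists>c. is_cycle T c)}"

definition component :: "('a, 'b) pre_digraph \<Rightarrow> 'a \<Rightarrow> 'a set" where
  "component G u = {x. u \<rightarrow>\<^sup>*\<^bsub>underlying G\<^esub> x}"

definition tail_component :: "('a, 'b) pre_digraph \<Rightarrow> 'b \<Rightarrow> 'a set" where
  "tail_component T e = component (pre_digraph.del_arc T e) (tail T e)"

definition head_component :: "('a, 'b) pre_digraph \<Rightarrow> 'b \<Rightarrow> 'a set" where
  "head_component T e = component (pre_digraph.del_arc T e) (head T e)"

definition graph_dist :: "('a, 'b) pre_digraph \<Rightarrow> 'a \<Rightarrow> 'a \<Rightarrow> nat" where
  "graph_dist G u v =
     (LEAST k. \<exists>p. vwalk p (underlying G) \<and> hd p = u \<and> last p = v \<and> vwalk_length p = k)"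

definition edge_dist :: "('a, 'b) pre_digraph \<Rightarrow> 'b \<Rightarrow> 'a \<Rightarrow> nat" where
  "edge_dist G e j = min (graph_dist G (tail G e) j) (graph_dist G (head G e) j)"

definition tree_path :: "('a, 'b) pre_digraph \<Rightarrow> 'a \<Rightarrow> 'a \<Rightarrow> 'a vwalk" where
  "tree_path T j u = (THE p. vpath p (underlying T) \<and> hd p = j \<and> last p = u)"


section \<open>Weights\<close>

text \<open>
  A weight function is given on ordered pairs of vertices; only its values on the end pairs
  (tail, head) of the arcs matter.
\<close>

definition adjacency :: "('a, 'b) pre_digraph \<Rightarrow> ('a \<Rightarrow> 'a \<Rightarrow> complex) \<Rightarrow> 'a \<Rightarrow> 'a \<Rightarrow> complex" where
  "adjacency G w i j =
     (if (i, j) \<in> arcs_ends G then w i j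
      else if (j, i) \<in> arcs_ends G then cnj (w j i)
      else 0)"

definition walk_weight :: "('a, 'b) pre_digraph \<Rightarrow> ('a \<Rightarrow> 'a \<Rightarrow> complex) \<Rightarrow> 'a vwalk \<Rightarrow> complex" where
  "walk_weight G w p = (\<Prod>(i, j)\<leftarrow>vwalk_arcs p. adjacency G w i j)"

definition edge_weight :: "('a, 'b) pre_digraph \<Rightarrow> ('a \<Rightarrow> 'a \<Rightarrow> complex) \<Rightarrow> 'b \<Rightarrow> complex" where
  "edge_weight G w e = w (tail G e) (head G e)"

definition weight_prod :: "('a, 'b) pre_digraph \<Rightarrow> ('a \<Rightarrow> 'a \<Rightarrow> complex) \<Rightarrow> complex" where
  "weight_prod H w = (\<Prod>e\<in>arcs H. edge_weight H w e)"


section \<open>Labelled matrices and the Moore--Penrose inverse\<close>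

text \<open>
  A complex matrix with rows labelled by a finite set \<open>R\<close> and columns labelled by a finite set \<open>C\<close>
  is a function \<open>M\<close> whose values \<open>M i j\<close> matter for \<open>i \<in> R\<close> and \<open>j \<in> C\<close> only. This lets the
  incidence matrix of a subgraph keep the vertex and edge labels of the whole graph.
\<close>

definition mat_mult ::
    "'k set \<Rightarrow> ('i \<Rightarrow> 'k \<Rightarrow> complex) \<Rightarrow> ('k \<Rightarrow> 'j \<Rightarrow> complex) \<Rightarrow> 'i \<Rightarrow> 'j \<Rightarrow> complex" where
  "mat_mult K A B i j = (\<Sum>k\<in>K. A i k * B k j)"

definition mat_eq_on :: "'i set \<Rightarrow> 'j set \<Rightarrow> ('i \<Rightarrow> 'j \<Rightarrow> complex) \<Rightarrow> ('i \<Rightarrow> 'j \<Rightarrow> complex) \<Rightarrow> bool" where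
  "mat_eq_on R C A B \<longleftrightarrow> (\<forall>i\<in>R. \<forall>j\<in>C. A i j = B i j)"

definition conj_transpose :: "('i \<Rightarrow> 'j \<Rightarrow> complex) \<Rightarrow> 'j \<Rightarrow> 'i \<Rightarrow> complex" where
  "conj_transpose A j i = cnj (A i j)"

text \<open>The four Penrose equations for an \<open>R \<times> C\<close> matrix \<open>M\<close> and a \<open>C \<times> R\<close> matrix \<open>X\<close>.\<close>

definition is_mp_inverse ::
    "'i set \<Rightarrow> 'j set \<Rightarrow> ('i \<Rightarrow> 'j \<Rightarrow> complex) \<Rightarrow> ('j \<Rightarrow> 'i \<Rightarrow> complex) \<Rightarrow> bool" where
  "is_mp_inverse R C M X \<longleftrightarrow>
     mat_eq_on R C (mat_mult R (mat_mult C M X) M) M \<and>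
     mat_eq_on C R (mat_mult C (mat_mult R X M) X) X \<and>
     mat_eq_on R R (conj_transpose (mat_mult C M X)) (mat_mult C M X) \<and>
     mat_eq_on C C (conj_transpose (mat_mult R X M)) (mat_mult R X M)"

text \<open>
  The Penrose equations determine the entries of \<open>X\<close> on \<open>C \<times> R\<close>; the value 0 outside the label sets
  makes \<open>X\<close> unique as a function.
\<close>

definition mp_inverse ::
    "'i set \<Rightarrow> 'j set \<Rightarrow> ('i \<Rightarrow> 'j \<Rightarrow> complex) \<Rightarrow> 'j \<Rightarrow> 'i \<Rightarrow> complex" where
  "mp_inverse R C M =
     (THE X. is_mp_inverse R C M X \<and> (\<forall>j i. j \<notin> C \<or> i \<notin> R \<longrightarrow> X j i = 0))"


section \<open>Signless Laplacian and signless incidence matrix\<close>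

definition signless_laplacian ::
    "('a, 'b) pre_digraph \<Rightarrow> ('a \<Rightarrow> 'a \<Rightarrow> complex) \<Rightarrow> 'a \<Rightarrow> 'a \<Rightarrow> complex" where
  "signless_laplacian G w i j =
     (if i = j then complex_of_real (\<Sum>l\<in>verts G - {i}. cmod (adjacency G w i l)) else 0)
     + adjacency G w i j"

definition signless_incidence ::
    "('a, 'b) pre_digraph \<Rightarrow> ('a \<Rightarrow> 'a \<Rightarrow> complex) \<Rightarrow> 'a \<Rightarrow> 'b \<Rightarrow> complex" where
  "signless_incidence G w i e =
     (if i = tail G e then csqrt (edge_weight G w e)
      else if i = head G e then csqrt (cnj (edge_weight G w e))
      else 0)"

definition laplacian_pinv ::
    "('a, 'b) pre_digraph \<Rightarrow> ('a \<Rightarrow> 'a \<Rightarrow> complex) \<Rightarrow> 'a \<Rightarrow> 'a \<Rightarrow> complex" where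
  "laplacian_pinv G w = mp_inverse (verts G) (verts G) (signless_laplacian G w)"

definition incidence_pinv ::
    "('a, 'b) pre_digraph \<Rightarrow> ('a \<Rightarrow> 'a \<Rightarrow> complex) \<Rightarrow> 'b \<Rightarrow> 'a \<Rightarrow> complex" where
  "incidence_pinv T w = mp_inverse (verts T) (arcs T) (signless_incidence T w)"

abbreviation neg_reals :: "complex set" where
  "neg_reals \<equiv> complex_of_real ` {..<0}"

abbreviation pos_reals :: "complex set" where
  "pos_reals \<equiv> complex_of_real ` {0<..}"

end

theory Submission
  imports Defs
begin

text \<open>
  The sign condition on cycles says that the products of the entries \<open>- a i j\<close> along all closed walks
  are positive, so there is a gauge \<open>z\<close> of unit complex numbers with
  \<open>- a i j = \<bar>a i j\<bar> * z i * cnj (z j)\<close>. In this gauge the signless incidence matrix \<open>N\<close> is the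
  ordinary incidence matrix with rows scaled by \<open>z\<close> and columns scaled by numbers \<open>c e\<close> with
  \<open>\<bar>c e\<bar>\<^sup>2 = \<bar>w e\<bar>\<close>. For a spanning tree \<open>T\<close> the pseudoinverse of \<open>N T\<close> is then explicit, and
  \<open>N T\<close> times it is the same projection for every \<open>T\<close>. The average \<open>X\<close> of these pseudoinverses with
  weights \<open>\<bar>W T\<bar>\<close> is the pseudoinverse of \<open>N\<close>: only the hermiticity of \<open>X N\<close> is not immediate, and
  it follows from the exchange \<open>T \<mapsto> T - e + f\<close>. Finally \<open>Q = N N*\<close> gives \<open>X* X\<close> as the
  pseudoinverse of \<open>Q\<close>.
\<close>

section \<open>The Moore--Penrose inverse\<close>

text \<open>\<open>Q\<close> is singular, because \<open>N*\<close> annihilates the vector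
  \<open>z\<close>; so \<open>N X\<close> can at best be the orthogonal projection along
  \<open>z\<close>. The pseudoinverse of a single tree, padded with zero rows, already satisfies
  \<open>N X N = N\<close> and \<open>X N X = X\<close> and has a hermitian \<open>N X\<close>. But
  its \<open>X N\<close> is an idempotent that depends on the tree and is in general not hermitian;
  this is the defect that averaging repairs, and the weights are dictated by how the entries of
  \<open>X N\<close> at \<open>(e, f)\<close> and \<open>(f, e)\<close> change under the exchange.
  The scaling \<open>c e\<close> is \<open>csqrt w * cnj (z t)\<close> for the tail \<open>t\<close>
  of \<open>e\<close>, so that the tail entries of \<open>N\<close> fit by definition. That the head
  entries fit too rests on the principal root commuting with conjugation, which fails on the branch
  cut; hence the exclusion of negative weights.\<close>

lemma mat_mult_assoc:
  "mat_mult L (mat_mult K A B) C = mat_mult K A (mat_mult L B C)"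
  unfolding mat_mult_def
  by (intro ext) (simp add: sum_distrib_left sum_distrib_right sum.swap[of _ K L] mult.assoc)

lemma mat_eq_on_refl: "mat_eq_on R C A A"
  and mat_eq_on_sym: "mat_eq_on R C A B \<Longrightarrow> mat_eq_on R C B A"
  and mat_eq_on_trans: "mat_eq_on R C A B \<Longrightarrow> mat_eq_on R C B D \<Longrightarrow> mat_eq_on R C A D"
  by (auto simp: mat_eq_on_def)

lemma mat_eq_on_mult:
  "mat_eq_on R K A A' \<Longrightarrow> mat_eq_on K C B B' \<Longrightarrow>
    mat_eq_on R C (mat_mult K A B) (mat_mult K A' B')"
  by (auto simp: mat_eq_on_def mat_mult_def intro!: sum.cong)

lemma conj_transpose_mult:
  "conj_transpose (mat_mult K A B) = mat_mult K (conj_transpose B) (conj_transpose A)"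
  by (intro ext) (simp add: conj_transpose_def mat_mult_def mult.commute)

lemma mat_eq_on_conj_transpose:
  "mat_eq_on R C A B \<Longrightarrow> mat_eq_on C R (conj_transpose A) (conj_transpose B)"
  by (simp add: mat_eq_on_def conj_transpose_def)

lemma hermitian_mult_swap:
  assumes "mat_eq_on R R (conj_transpose P) P" "mat_eq_on R R (conj_transpose Q) Q"
    and "mat_eq_on R R (conj_transpose S) S" "mat_eq_on R R (mat_mult R P Q) S"
  shows "mat_eq_on R R (mat_mult R Q P) S"
proof -
  have "mat_eq_on R R (mat_mult R Q P) (mat_mult R (conj_transpose Q) (conj_transpose P))"
    by (intro mat_eq_on_mult assms(1,2)[THEN mat_eq_on_sym])
  moreover have "mat_eq_on R R (mat_mult R (conj_transpose Q) (conj_transpose P)) (conj_transpose S)"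
    using mat_eq_on_conj_transpose[OF assms(4)] by (simp add: conj_transpose_mult)
  ultimately show ?thesis
    using assms(3) by (meson mat_eq_on_trans)
qed

text \<open>The product \<open>M Y M X\<close> collapses to \<open>M X\<close>, and also to
  \<open>M Y\<close> after taking adjoints in \<open>M X M Y = M Y\<close>. In the same way
  \<open>X M = Y M\<close>, and then \<open>X = X M X = X M Y = Y M Y = Y\<close>.\<close>

lemma mp_inverse_unique:
  assumes X: "is_mp_inverse R C M X" and Y: "is_mp_inverse R C M Y"
  shows "mat_eq_on C R X Y"
proof -
  have MXM: "mat_eq_on R C (mat_mult C M (mat_mult R X M)) M"
    and XMX: "mat_eq_on C R (mat_mult R X (mat_mult C M X)) X"
    and MYM: "mat_eq_on R C (mat_mult C M (mat_mult R Y M)) M"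
    and YMY: "mat_eq_on C R (mat_mult R Y (mat_mult C M Y)) Y"
    and herm: "mat_eq_on R R (conj_transpose (mat_mult C M X)) (mat_mult C M X)"
      "mat_eq_on R R (conj_transpose (mat_mult C M Y)) (mat_mult C M Y)"
      "mat_eq_on C C (conj_transpose (mat_mult R X M)) (mat_mult R X M)"
      "mat_eq_on C C (conj_transpose (mat_mult R Y M)) (mat_mult R Y M)"
    using X Y by (auto simp: is_mp_inverse_def mat_mult_assoc)
  have "mat_eq_on R R (mat_mult R (mat_mult C M Y) (mat_mult C M X)) (mat_mult C M Y)"
    by (rule hermitian_mult_swap)
      (use herm mat_eq_on_mult[OF MXM mat_eq_on_refl[of C R Y]] in \<open>simp_all add: mat_mult_assoc\<close>)
  moreover have "mat_eq_on R R (mat_mult R (mat_mult C M Y) (mat_mult C M X)) (mat_mult C M X)"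
    using mat_eq_on_mult[OF MYM mat_eq_on_refl[of C R X]] by (simp add: mat_mult_assoc)
  ultimately have MX: "mat_eq_on R R (mat_mult C M X) (mat_mult C M Y)"
    by (meson mat_eq_on_sym mat_eq_on_trans)
  have "mat_eq_on C C (mat_mult C (mat_mult R Y M) (mat_mult R X M)) (mat_mult R X M)"
    by (rule hermitian_mult_swap)
      (use herm mat_eq_on_mult[OF mat_eq_on_refl[of C R X] MYM] in \<open>simp_all add: mat_mult_assoc\<close>)
  moreover have "mat_eq_on C C (mat_mult C (mat_mult R Y M) (mat_mult R X M)) (mat_mult R Y M)"
    using mat_eq_on_mult[OF mat_eq_on_refl[of C R Y] MXM] by (simp add: mat_mult_assoc)
  ultimately have XM: "mat_eq_on C C (mat_mult R X M) (mat_mult R Y M)"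
    by (meson mat_eq_on_sym mat_eq_on_trans)
  have "mat_eq_on C R X (mat_mult R X (mat_mult C M Y))"
    using mat_eq_on_mult[OF mat_eq_on_refl[of C R X] MX] XMX
    by (meson mat_eq_on_sym mat_eq_on_trans)
  moreover have "mat_eq_on C R (mat_mult R X (mat_mult C M Y)) (mat_mult R Y (mat_mult C M Y))"
    using mat_eq_on_mult[OF XM mat_eq_on_refl[of C R Y]] by (simp add: mat_mult_assoc)
  ultimately show ?thesis
    using YMY by (meson mat_eq_on_trans)
qed

lemma is_mp_inverse_cong:
  assumes "is_mp_inverse R C M X" and eq: "mat_eq_on C R Y X"
  shows "is_mp_inverse R C M Y"
proof -
  have MY: "mat_eq_on R R (mat_mult C M Y) (mat_mult C M X)"
    and YM: "mat_eq_on C C (mat_mult R Y M) (mat_mult R X M)"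
    by (intro mat_eq_on_mult mat_eq_on_refl eq)+
  have "mat_eq_on R C (mat_mult R (mat_mult C M Y) M) (mat_mult R (mat_mult C M X) M)"
    "mat_eq_on C R (mat_mult C (mat_mult R Y M) Y) (mat_mult C (mat_mult R X M) X)"
    by (intro mat_eq_on_mult mat_eq_on_refl eq MY YM)+
  with MY[THEN mat_eq_on_conj_transpose] YM[THEN mat_eq_on_conj_transpose] MY YM eq assms(1)
  show ?thesis
    unfolding is_mp_inverse_def by (meson mat_eq_on_sym mat_eq_on_trans)
qed

lemma mp_inverse_eqI:
  assumes "is_mp_inverse R C M X" "j \<in> C" "i \<in> R"
  shows "mp_inverse R C M j i = X j i"
proof -
  \<comment> \<open>The Penrose equations leave \<open>X\<close> arbitrary off the labels, whereas
    \<open>mp_inverse\<close> selects the representative that is 0 there.\<close>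
  define Y where "Y = (\<lambda>j i. if j \<in> C \<and> i \<in> R then X j i else 0)"
  have Y: "is_mp_inverse R C M Y"
    using assms(1) by (rule is_mp_inverse_cong) (simp add: Y_def mat_eq_on_def)
  have "mp_inverse R C M = Y"
    unfolding mp_inverse_def
  proof (rule the_equality)
    show "is_mp_inverse R C M Y \<and> (\<forall>j i. j \<notin> C \<or> i \<notin> R \<longrightarrow> Y j i = 0)"
      using Y by (simp add: Y_def)
  next
    fix Z
    assume Z: "is_mp_inverse R C M Z \<and> (\<forall>j i. j \<notin> C \<or> i \<notin> R \<longrightarrow> Z j i = 0)"
    show "Z = Y"
    proof (intro ext)
      fix j i
      show "Z j i = Y j i"
      proof (cases "j \<in> C \<and> i \<in> R")
        case True
        then show ?thesis
          using mp_inverse_unique[OF conjunct1[OF Z] Y] by (simp add: mat_eq_on_def)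
      next
        case False
        then show ?thesis
          using Z by (auto simp: Y_def)
      qed
    qed
  qed
  then show ?thesis
    using assms by (simp add: Y_def)
qed

lemma is_mp_inverse_cong_matrix:
  assumes "is_mp_inverse R C M X" and eq: "mat_eq_on R C N M"
  shows "is_mp_inverse R C N X"
proof -
  have NX: "mat_eq_on R R (mat_mult C N X) (mat_mult C M X)"
    and XN: "mat_eq_on C C (mat_mult R X N) (mat_mult R X M)"
    by (intro mat_eq_on_mult mat_eq_on_refl eq)+
  have "mat_eq_on R C (mat_mult R (mat_mult C N X) N) (mat_mult R (mat_mult C M X) M)"
    "mat_eq_on C R (mat_mult C (mat_mult R X N) X) (mat_mult C (mat_mult R X M) X)"
    by (intro mat_eq_on_mult mat_eq_on_refl eq NX XN)+
  with NX[THEN mat_eq_on_conj_transpose] XN[THEN mat_eq_on_conj_transpose] NX XN eq assms(1)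
  show ?thesis
    unfolding is_mp_inverse_def by (meson mat_eq_on_sym mat_eq_on_trans)
qed

text \<open>With \<open>Q = N N*\<close> and \<open>L = X* X\<close>, hermiticity of
  \<open>X N\<close> gives \<open>Q L = N (X N)* X = N X N X = P\<close>, and
  \<open>L Q = (Q L)* = P\<close> since \<open>P\<close> is hermitian. The remaining equations
  reduce to \<open>P N = N\<close> and \<open>X P = X\<close>.\<close>

lemma is_mp_inverse_gram:
  assumes P: "mat_eq_on R R (conj_transpose P) P"
    and NX: "mat_eq_on R R (mat_mult C N X) P"
    and PN: "mat_eq_on R C (mat_mult R P N) N"
    and XP: "mat_eq_on C R (mat_mult R X P) X"
    and XN: "mat_eq_on C C (conj_transpose (mat_mult R X N)) (mat_mult R X N)"
  shows "is_mp_inverse R R (mat_mult C N (conj_transpose N)) (mat_mult C (conj_transpose X) X)"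
    (is "is_mp_inverse R R ?Q ?L")
proof -
  have conj2: "conj_transpose (conj_transpose A) = A" for A :: "'x \<Rightarrow> 'y \<Rightarrow> complex"
    by (simp add: conj_transpose_def fun_eq_iff)
  have "mat_eq_on C R (mat_mult C (conj_transpose (mat_mult R X N)) X) (mat_mult C (mat_mult R X N) X)"
    by (intro mat_eq_on_mult mat_eq_on_refl XN)
  then have "mat_eq_on R R (mat_mult C N (mat_mult C (conj_transpose (mat_mult R X N)) X))
      (mat_mult C N (mat_mult C (mat_mult R X N) X))"
    by (rule mat_eq_on_mult[OF mat_eq_on_refl])
  then have "mat_eq_on R R (mat_mult R ?Q ?L) (mat_mult R (mat_mult C N X) (mat_mult C N X))"
    by (simp add: mat_mult_assoc conj_transpose_mult)
  moreover have "mat_eq_on R R (mat_mult R (mat_mult C N X) (mat_mult C N X)) (mat_mult R P (mat_mult C N X))"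
    by (intro mat_eq_on_mult mat_eq_on_refl NX)
  moreover have "mat_eq_on R R (mat_mult R P (mat_mult C N X)) (mat_mult C N X)"
    using mat_eq_on_mult[OF PN mat_eq_on_refl[of C R X]] by (simp add: mat_mult_assoc)
  ultimately have QL: "mat_eq_on R R (mat_mult R ?Q ?L) P"
    using NX by (meson mat_eq_on_trans)
  have "conj_transpose (mat_mult R ?Q ?L) = mat_mult R ?L ?Q"
    by (simp add: conj_transpose_mult conj2)
  then have LQ: "mat_eq_on R R (mat_mult R ?L ?Q) P"
    using mat_eq_on_trans[OF mat_eq_on_conj_transpose[OF QL] P] by simp
  have "mat_eq_on R R (mat_mult R P ?Q) ?Q"
    using mat_eq_on_mult[OF PN mat_eq_on_refl[of C R "conj_transpose N"]] by (simp add: mat_mult_assoc)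
  then have "mat_eq_on R R (mat_mult R (mat_mult R ?Q ?L) ?Q) ?Q"
    by (rule mat_eq_on_trans[OF mat_eq_on_mult[OF QL mat_eq_on_refl]])
  moreover have "mat_eq_on R R (mat_mult R ?L P) ?L"
    using mat_eq_on_mult[OF mat_eq_on_refl[of R C "conj_transpose X"] XP] by (simp add: mat_mult_assoc)
  then have "mat_eq_on R R (mat_mult R (mat_mult R ?L ?Q) ?L) ?L"
    using mat_eq_on_trans[OF mat_eq_on_mult[OF mat_eq_on_refl[of R R ?L] QL]]
    by (simp add: mat_mult_assoc)
  moreover have "mat_eq_on R R (conj_transpose (mat_mult R ?Q ?L)) (mat_mult R ?Q ?L)"
    "mat_eq_on R R (conj_transpose (mat_mult R ?L ?Q)) (mat_mult R ?L ?Q)"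
    using P QL LQ QL[THEN mat_eq_on_conj_transpose] LQ[THEN mat_eq_on_conj_transpose]
    by (meson mat_eq_on_sym mat_eq_on_trans)+
  ultimately show ?thesis
    by (simp add: is_mp_inverse_def)
qed

section \<open>Products along vertex walks\<close>

text \<open>The entries \<open>f\<close> are arbitrary because the negated adjacency matrix and
  constant functions occur besides the adjacency matrix itself.\<close>

definition walk_prod :: "('a \<Rightarrow> 'a \<Rightarrow> complex) \<Rightarrow> 'a vwalk \<Rightarrow> complex" where
  "walk_prod f p = (\<Prod>(i, j)\<leftarrow>vwalk_arcs p. f i j)"

lemma walk_prod_simps [simp]:
  "walk_prod f [x] = 1"
  "walk_prod f (x # y # p) = f x y * walk_prod f (y # p)"
  by (simp_all add: walk_prod_def)

lemma walk_prod_append: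
  "walk_prod f (p @ x # q) = walk_prod f (p @ [x]) * walk_prod f (x # q)"
proof (induction p)
  case (Cons y p)
  then show ?case by (cases p) auto
qed simp

lemma walk_weight_eq: "walk_weight G w = walk_prod (adjacency G w)"
  by (intro ext) (simp add: walk_weight_def walk_prod_def)

lemma walk_prod_uminus:
  "walk_prod (\<lambda>i j. - f i j) p = (-1) ^ vwalk_length p * walk_prod f p"
  by (induction p rule: vwalk_arcs.induct) (auto simp: walk_prod_def)

lemma walk_prod_rev:
  assumes "\<And>i j. (i, j) \<in> set (vwalk_arcs p) \<Longrightarrow> f j i = cnj (f i j)"
  shows "walk_prod f (rev p) = cnj (walk_prod f p)"
  using assms
proof (induction p rule: vwalk_arcs.induct)
  case (3 x y p)
  have "walk_prod f (rev (x # y # p)) = walk_prod f (rev p @ y # [x])"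
    by simp
  also have "\<dots> = walk_prod f (rev (y # p)) * f y x"
    by (subst walk_prod_append) simp
  finally show ?case
    using 3 by simp
qed (auto simp: walk_prod_def)

lemma pos_reals_iff: "z \<in> pos_reals \<longleftrightarrow> Re z > 0 \<and> Im z = 0"
  by (auto simp: complex_eq_iff image_iff)

lemma neg_reals_iff: "z \<in> neg_reals \<longleftrightarrow> Re z < 0 \<and> Im z = 0"
  by (auto simp: complex_eq_iff image_iff)

lemma pos_reals_mult: "a \<in> pos_reals \<Longrightarrow> b \<in> pos_reals \<Longrightarrow> a * b \<in> pos_reals"
  by (simp add: pos_reals_iff)

lemma sgn_pos_reals: "z \<in> pos_reals \<Longrightarrow> sgn z = 1"
  by (auto simp: sgn_of_real)

lemma sgn_cnj: "sgn (cnj z) = cnj (sgn z)"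
  by (simp add: sgn_eq)

text \<open>At a negative real the two sides would be opposite numbers: conjugation fixes the
  radicand, but its principal root is imaginary.\<close>

lemma csqrt_cnj: "z \<notin> neg_reals \<Longrightarrow> csqrt (cnj z) = cnj (csqrt z)"
  by (auto simp: complex_eq_iff neg_reals_iff sgn_minus cmod_def)

section \<open>The link relation of a set of arcs\<close>

text \<open>With the arc set as a parameter, deleting and exchanging arcs become set operations, and
  connection in what remains is a reflexive transitive closure.\<close>

definition links :: "('a, 'b) pre_digraph \<Rightarrow> 'b set \<Rightarrow> ('a \<times> 'a) set" where
  "links G E = (\<Union>e\<in>E. {(tail G e, head G e), (head G e, tail G e)})"

lemma linksE:
  assumes "(x, y) \<in> links G E"
  obtains e where "e \<in> E" "x = tail G e \<and> y = head G e \<or> x = head G e \<and> y = tail G e"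
  using assms by (auto simp: links_def)

lemma links_arc: "e \<in> E \<Longrightarrow> (tail G e, head G e) \<in> links G E"
  and links_arc_rev: "e \<in> E \<Longrightarrow> (head G e, tail G e) \<in> links G E"
  by (auto simp: links_def)

lemma links_mono: "E \<subseteq> F \<Longrightarrow> links G E \<subseteq> links G F"
  by (auto simp: links_def)

lemma links_sym: "(x, y) \<in> links G E \<Longrightarrow> (y, x) \<in> links G E"
  by (auto simp: links_def)

lemma links_rtrancl_mono: "E \<subseteq> F \<Longrightarrow> (x, y) \<in> (links G E)\<^sup>* \<Longrightarrow> (x, y) \<in> (links G F)\<^sup>*"
  using rtrancl_mono[OF links_mono] by blast

lemma links_rtrancl_sym: "(x, y) \<in> (links G E)\<^sup>* \<Longrightarrow> (y, x) \<in> (links G E)\<^sup>*"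
  using sym_rtrancl[of "links G E"] by (auto simp: sym_def intro: links_sym)

text \<open>One crossing of \<open>f\<close> is enough. Each crossing ends at an end of
  \<open>f\<close>, and there the three cases reset, either to a connection without \<open>f\<close>
  or to a single crossing.\<close>

lemma links_rtrancl_insert:
  assumes "(x, y) \<in> (links G (insert f E))\<^sup>*"
  shows "(x, y) \<in> (links G E)\<^sup>* \<or>
    (x, tail G f) \<in> (links G E)\<^sup>* \<and> (head G f, y) \<in> (links G E)\<^sup>* \<or>
    (x, head G f) \<in> (links G E)\<^sup>* \<and> (tail G f, y) \<in> (links G E)\<^sup>*"
  using assms
proof (induction rule: rtrancl_induct)
  case (step y z)
  from step.hyps(2) obtain e where e: "e \<in> insert f E"
    "y = tail G e \<and> z = head G e \<or> y = head G e \<and> z = tail G e"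
    by (rule linksE)
  show ?case
  proof (cases "e \<in> E")
    case True
    then have "(y, z) \<in> links G E"
      using e(2) links_arc links_arc_rev by metis
    then show ?thesis
      using step.IH by (meson rtrancl.rtrancl_into_rtrancl)
  next
    case False
    then show ?thesis
      using e step.IH by auto
  qed
qed simp

lemma verts_underlying [simp]: "verts (underlying G) = verts G"
  and arcs_ends_underlying: "arcs_ends (underlying G) = links G (arcs G)"
  by (simp_all add: underlying_def parcs_mk_symmetric links_def)

lemma vwalk_underlying_iff:
  "vwalk p (underlying G) \<longleftrightarrow> set p \<subseteq> verts G \<and> set (vwalk_arcs p) \<subseteq> links G (arcs G) \<and> p \<noteq> []"
  by (simp add: vwalk_def arcs_ends_underlying)

lemma vwalk_rev_underlying: "vwalk p (underlying G) \<Longrightarrow> vwalk (rev p) (underlying G)"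
  by (rule vwalk_rev_ex) (auto simp: symmetric_def arcs_ends_underlying sym_def intro: links_sym)

lemma vwalk_arcs_reachable:
  assumes "set (vwalk_arcs p) \<subseteq> R" "p \<noteq> []"
  shows "(hd p, last p) \<in> R\<^sup>*"
  using assms
proof (induction p rule: vwalk_arcs.induct)
  case (3 x y p)
  then show ?case by (auto intro: converse_rtrancl_into_rtrancl)
qed auto

context wf_digraph
begin

lemma wf_underlying: "wf_digraph (underlying G)"
  unfolding underlying_def wf_digraph_wp_iff by (rule wellformed_mk_symmetric)

lemma links_in_verts:
  "(x, y) \<in> links G E \<Longrightarrow> E \<subseteq> arcs G \<Longrightarrow> x \<in> verts G \<and> y \<in> verts G"
  by (auto simp: links_def)

lemma links_rtrancl_in_verts:
  "(x, y) \<in> (links G E)\<^sup>* \<Longrightarrow> x \<in> verts G \<Longrightarrow> E \<subseteq> arcs G \<Longrightarrow> y \<in> verts G"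
  by (induction rule: rtrancl_induct) (auto dest: links_in_verts)

lemma reachable_underlying_iff:
  "x \<in> verts G \<Longrightarrow> x \<rightarrow>\<^sup>*\<^bsub>underlying G\<^esub> y \<longleftrightarrow> (x, y) \<in> (links G (arcs G))\<^sup>*"
  using wf_digraph.reachable_conv'[OF wf_underlying] by (simp add: arcs_ends_underlying)

lemma vpath_underlying_exists:
  assumes "x \<in> verts G" "(x, y) \<in> (links G (arcs G))\<^sup>*"
  obtains p where "vpath p (underlying G)" "hd p = x" "last p = y"
  using assms wf_digraph.reachable_vpath_conv[OF wf_underlying, of x y]
  by (auto simp: reachable_underlying_iff)

lemma connected_iff:
  "connected G \<longleftrightarrow>
    verts G \<noteq> {} \<and> (\<forall>x\<in>verts G. \<forall>y\<in>verts G. (x, y) \<in> (links G (arcs G))\<^sup>*)"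
  unfolding connected_def strongly_connected_def underlying_def[symmetric]
  by (auto simp: reachable_underlying_iff)

end

section \<open>Positive closed walks and the gauge\<close>

context oriented_graph
begin

lemma tail_neq_head: "e \<in> arcs G \<Longrightarrow> tail G e \<noteq> head G e"
  by (rule no_loops)

lemma arcs_eqI:
  assumes "e \<in> arcs G" "f \<in> arcs G"
    "tail G e = tail G f \<and> head G e = head G f \<or> tail G e = head G f \<and> head G e = tail G f"
  shows "e = f"
  using assms no_multi_arcs[of e f] no_opposite_arcs[of "tail G e" "head G e"]
  by (auto simp: arc_to_ends_def arcs_ends_conv)

lemma links_irrefl: "(x, x) \<notin> links G (arcs G)"
  by (auto elim!: linksE dest: tail_neq_head)

text \<open>
  A closed walk with a repeated inner vertex splits into two shorter closed walks; a closed walk of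
  length 2 runs back and forth along one edge, and longer ones without repetition are cycles.
\<close>

lemma closed_walk_prod_pos:
  fixes f :: "'a \<Rightarrow> 'a \<Rightarrow> complex"
  assumes herm: "\<And>i j. (i, j) \<in> links G (arcs G) \<Longrightarrow> f j i = cnj (f i j)"
    and nz: "\<And>i j. (i, j) \<in> links G (arcs G) \<Longrightarrow> f i j \<noteq> 0"
    and cyc: "\<And>c. is_cycle G c \<Longrightarrow> walk_prod f c \<in> pos_reals"
    and walk: "vwalk c (underlying G)" "hd c = last c"
  shows "walk_prod f c \<in> pos_reals"
  using walk
proof (induction c rule: length_induct)
  case (1 c)
  note walk = \<open>vwalk c (underlying G)\<close>
  from 1 obtain x p where c: "c = x # p"
    by (cases c) (auto simp: vwalk_def)
  show ?case
  proof (cases "distinct p")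
    case False
    then obtain p1 y p2 p3 where p: "p = p1 @ [y] @ p2 @ [y] @ p3"
      using not_distinct_decomp by blast
    have c1: "c = (x # p1) @ (y # p2 @ [y]) @ p3" and c2: "c = ((x # p1) @ y # p2) @ y # p3"
      and c3: "c = ((x # p1) @ [y]) @ (p2 @ y # p3)"
      by (simp_all add: c p)
    have inner: "vwalk (y # p2 @ [y]) (underlying G)"
      using vwalkI_append_l[OF _ vwalkI_append_r[OF _ walk[unfolded c1]]] by simp
    have right: "vwalk (y # p3) (underlying G)"
      using vwalkI_append_r[OF _ walk[unfolded c2]] by simp
    have left: "vwalk ((x # p1) @ [y]) (underlying G)"
      using vwalkI_append_l[OF _ walk[unfolded c3]] by simp
    have outer: "vwalk ((x # p1) @ y # p3) (underlying G)"
      using vwalk_joinI_vwalk'[OF left right] by (simp add: vwalk_join_def)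
    have "walk_prod f c = walk_prod f ((x # p1) @ [y]) * (walk_prod f (y # p2 @ [y]) * walk_prod f (y # p3))"
      using walk_prod_append[of f "x # p1" y "p2 @ [y] @ p3"] walk_prod_append[of f "y # p2" y p3]
      by (simp add: c p)
    also have "\<dots> = walk_prod f (y # p2 @ [y]) * walk_prod f ((x # p1) @ y # p3)"
      using walk_prod_append[of f "x # p1" y p3] by simp
    finally have eq: "walk_prod f c = \<dots>" .
    have "walk_prod f (y # p2 @ [y]) \<in> pos_reals"
      using 1 inner by (auto simp: c p)
    moreover have "walk_prod f ((x # p1) @ y # p3) \<in> pos_reals"
      using 1 outer by (auto simp: c p split: if_splits)
    ultimately show ?thesis
      unfolding eq by (rule pos_reals_mult)
  next
    case True
    consider "p = []" | y where "p = [y]" | y z where "p = [y, z]" | "length p \<ge> 3"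
      by (cases "length p \<ge> 3") (auto simp: not_le numeral_3_eq_3 less_Suc_eq length_Suc_conv)
    then show ?thesis
    proof cases
      case 1
      then show ?thesis by (simp add: c walk_prod_def pos_reals_iff)
    next
      case 2
      then show ?thesis
        using walk \<open>hd c = last c\<close> links_irrefl by (auto simp: c vwalk_underlying_iff)
    next
      case 3
      then have "(x, y) \<in> links G (arcs G)" "z = x"
        using walk \<open>hd c = last c\<close> by (auto simp: c vwalk_underlying_iff)
      then show ?thesis
        using herm[of x y] nz[of x y] 3
        by (simp add: c complex_norm_square[symmetric] pos_reals_iff flip: of_real_power)
    next
      case 4
      then have "is_cycle G c"
        using walk \<open>hd c = last c\<close> True by (auto simp: is_cycle_def c)
      then show ?thesis by (rule cyc)
    qed
  qed
qed

end

text \<open>The phases telescope: \<open>cnj (z y) * z y = 1\<close> at each inner vertex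
  \<open>y\<close>, so only the two end phases remain.\<close>

lemma walk_prod_gauge:
  assumes "\<And>i j. (i, j) \<in> set (vwalk_arcs p) \<Longrightarrow> f i j = of_real (cmod (f i j)) * (z i * cnj (z j))"
    and "\<And>i. i \<in> set p \<Longrightarrow> cmod (z i) = 1" and "p \<noteq> []"
  shows "walk_prod f p = of_real (cmod (walk_prod f p)) * (z (hd p) * cnj (z (last p)))"
  using assms
proof (induction p rule: vwalk_arcs.induct)
  case (2 x)
  then show ?case by (simp add: complex_norm_square[symmetric])
next
  case (3 x y p)
  have y: "cnj (z y) * z y = 1"
    using 3(3)[of y] by (simp add: complex_norm_square[symmetric] mult.commute)
  have "walk_prod f (x # y # p) = (of_real (cmod (f x y)) * (z x * cnj (z y))) *
      (of_real (cmod (walk_prod f (y # p))) * (z y * cnj (z (last (y # p)))))"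
    using 3 by simp
  also have "\<dots> = of_real (cmod (walk_prod f (x # y # p))) * (z x * (cnj (z y) * z y) * cnj (z (last (y # p))))"
    by (simp add: norm_mult mult_ac)
  finally show ?case
    unfolding y by simp
qed simp

context oriented_graph
begin

text \<open>The phase at \<open>i\<close> is that of the product along a walk chosen from
  \<open>i\<close> to a fixed root. For an edge from \<open>i\<close> to \<open>j\<close>, the
  closed walk from the root to \<open>i\<close>, over the edge to \<open>j\<close> and back to the
  root has a positive product, which compares the two phases.\<close>

lemma gauge_exists:
  fixes f :: "'a \<Rightarrow> 'a \<Rightarrow> complex"
  assumes conn: "connected G"
    and herm: "\<And>i j. (i, j) \<in> links G (arcs G) \<Longrightarrow> f j i = cnj (f i j)"
    and nz: "\<And>i j. (i, j) \<in> links G (arcs G) \<Longrightarrow> f i j \<noteq> 0"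
    and cyc: "\<And>c. is_cycle G c \<Longrightarrow> walk_prod f c \<in> pos_reals"
  obtains z where "\<And>i. i \<in> verts G \<Longrightarrow> cmod (z i) = 1"
    "\<And>i j. (i, j) \<in> links G (arcs G) \<Longrightarrow> f i j = of_real (cmod (f i j)) * (z i * cnj (z j))"
proof -
  obtain r where r: "r \<in> verts G"
    using conn by (auto simp: connected_iff)
  have "\<exists>p. vwalk p (underlying G) \<and> hd p = i \<and> last p = r" if "i \<in> verts G" for i
    using vpath_underlying_exists[of i r] conn that r
    by (metis connected_iff vpath_def)
  then obtain p where p: "\<And>i. i \<in> verts G \<Longrightarrow> vwalk (p i) (underlying G) \<and> hd (p i) = i \<and> last (p i) = r"
    by metis
  define z where "z i = sgn (walk_prod f (p i))" for i
  have p_nz: "walk_prod f (p i) \<noteq> 0" if "i \<in> verts G" for i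
    using p[OF that] nz unfolding walk_prod_def vwalk_underlying_iff
    by (auto simp: prod_list_zero_iff)
  have z1: "cmod (z i) = 1" if "i \<in> verts G" for i
    using p_nz[OF that] by (simp add: z_def norm_sgn)
  have edge: "f i j = of_real (cmod (f i j)) * (z i * cnj (z j))"
    if ij: "(i, j) \<in> links G (arcs G)" for i j
  proof -
    have i: "i \<in> verts G" and j: "j \<in> verts G"
      using links_in_verts[OF ij] by auto
    obtain qi where qi: "p i = i # qi"
      using p[OF i] by (cases "p i") (auto simp: vwalk_def)
    obtain qj where qj: "p j = j # qj"
      using p[OF j] by (cases "p j") (auto simp: vwalk_def)
    define c where "c = rev (p i) @ p j"
    have j_walk: "vwalk (i # p j) (underlying G)"
      using p[OF j] i ij by (intro vwalk_consI) (auto simp: arcs_ends_underlying)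
    have "vwalk (rev (p i) \<oplus> (i # p j)) (underlying G)"
      using vwalk_rev_underlying[of "p i" G] p[OF i] j_walk
      by (intro vwalk_joinI_vwalk') (simp_all add: last_rev qi)
    then have walk: "vwalk c (underlying G)"
      by (simp add: vwalk_join_def c_def)
    have "hd c = last c"
      using p[OF i] p[OF j] by (auto simp: c_def qi qj hd_append last_rev hd_rev split: if_splits)
    then have "walk_prod f c \<in> pos_reals"
      by (intro closed_walk_prod_pos[where f = f and c = c] walk) (use herm nz cyc in blast)+
    moreover have "walk_prod f c = walk_prod f (rev (p i)) * (f i j * walk_prod f (p j))"
      using walk_prod_append[of f "rev qi" i "p j"] by (simp add: c_def qi qj)
    moreover have "walk_prod f (rev (p i)) = cnj (walk_prod f (p i))"
      using p[OF i] herm by (intro walk_prod_rev) (auto simp: vwalk_underlying_iff)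
    ultimately have "cnj (walk_prod f (p i)) * (f i j * walk_prod f (p j)) \<in> pos_reals"
      by simp
    then have "sgn (cnj (walk_prod f (p i)) * (f i j * walk_prod f (p j))) = 1"
      by (rule sgn_pos_reals)
    then have "cnj (z i) * (sgn (f i j) * z j) = 1"
      unfolding sgn_mult sgn_cnj z_def .
    then have "z i * cnj (z j) = (z i * cnj (z i)) * sgn (f i j) * (z j * cnj (z j))"
      by (simp add: algebra_simps)
    also have "\<dots> = sgn (f i j)"
      using z1[OF i] z1[OF j] by (simp add: complex_norm_square[symmetric])
    finally show ?thesis
      using nz[OF ij] by (simp add: sgn_eq)
  qed
  show thesis
    using that z1 edge by blast
qed

end

section \<open>Trees\<close>

text \<open>Acyclicity in terms of reachability alone, the form in which an arc exchange can be
  checked; \<open>acyclic_iff\<close> ties it to cycles.\<close>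

definition all_bridges :: "('a, 'b) pre_digraph \<Rightarrow> bool" where
  "all_bridges G \<longleftrightarrow> (\<forall>e\<in>arcs G. (tail G e, head G e) \<notin> (links G (arcs G - {e}))\<^sup>*)"

definition tail_side :: "('a, 'b) pre_digraph \<Rightarrow> 'b set \<Rightarrow> 'b \<Rightarrow> 'a set" where
  "tail_side G E e = {x. (tail G e, x) \<in> (links G (E - {e}))\<^sup>*}"

definition head_side :: "('a, 'b) pre_digraph \<Rightarrow> 'b set \<Rightarrow> 'b \<Rightarrow> 'a set" where
  "head_side G E e = {x. (head G e, x) \<in> (links G (E - {e}))\<^sup>*}"

lemma links_remove:
  "(x, y) \<in> links G E \<Longrightarrow> (x, y) \<noteq> (tail G e, head G e) \<Longrightarrow> (x, y) \<noteq> (head G e, tail G e) \<Longrightarrow>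
    (x, y) \<in> links G (E - {e})"
  by (auto simp: links_def)

lemma graph_dist_le:
  "vwalk p (underlying G) \<Longrightarrow> graph_dist G (hd p) (last p) \<le> vwalk_length p"
  unfolding graph_dist_def by (rule Least_le) blast

lemma graph_dist_attained:
  assumes "vwalk p (underlying G)"
  obtains q where "vwalk q (underlying G)" "hd q = hd p" "last q = last p"
    "vwalk_length q = graph_dist G (hd p) (last p)"
proof -
  have "\<exists>k q. vwalk q (underlying G) \<and> hd q = hd p \<and> last q = last p \<and> vwalk_length q = k"
    using assms by blast
  from LeastI_ex[OF this] show thesis
    using that unfolding graph_dist_def by blast
qed

text \<open>Cut the walk where it first enters \<open>S\<close>: that vertex must be
  \<open>u\<close>, and the part cut off contains at least the first vertex, hence the strict
  inequality.\<close>

lemma walk_enters_at: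
  assumes enter: "\<And>x y. (x, y) \<in> links G (arcs G) \<Longrightarrow> x \<notin> S \<Longrightarrow> y \<in> S \<Longrightarrow> y = u"
    and walk: "vwalk p (underlying G)" and "hd p \<notin> S" "last p \<in> S"
  shows "\<exists>q. vwalk q (underlying G) \<and> hd q = u \<and> last q = last p \<and> length q < length p"
  using walk \<open>hd p \<notin> S\<close> \<open>last p \<in> S\<close>
proof (induction p rule: vwalk_arcs.induct)
  case (3 x y p)
  have xy: "(x, y) \<in> links G (arcs G)" and walk': "vwalk (y # p) (underlying G)"
    using 3(2) by (auto simp: vwalk_underlying_iff)
  show ?case
  proof (cases "y \<in> S")
    case True
    then have "y = u"
      using enter[OF xy] 3(3) by simp
    then show ?thesis
      using walk' by (intro exI[of _ "y # p"]) simp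
  next
    case False
    then show ?thesis
      using 3(1)[OF walk'] 3(4) by force
  qed
qed (auto simp: vwalk_def)

text \<open>Cutting a shortest walk from \<open>v\<close> at its entry into \<open>S\<close> leaves
  a shorter walk from \<open>u\<close>. Later \<open>S\<close> is one side of a tree arc and
  \<open>u\<close> the end of the arc on that side.\<close>

lemma graph_dist_less_of_side:
  assumes enter: "\<And>x y. (x, y) \<in> links G (arcs G) \<Longrightarrow> x \<notin> S \<Longrightarrow> y \<in> S \<Longrightarrow> y = u"
    and "j \<in> S" "v \<notin> S" and walk: "vwalk p (underlying G)" "hd p = v" "last p = j"
  shows "graph_dist G u j < graph_dist G v j"
proof -
  obtain q where q: "vwalk q (underlying G)" "hd q = v" "last q = j" "vwalk_length q = graph_dist G v j"
    using graph_dist_attained[OF walk(1)] walk(2,3) by auto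
  have "\<exists>r. vwalk r (underlying G) \<and> hd r = u \<and> last r = last q \<and> length r < length q"
    by (rule walk_enters_at[where S = S]) (use enter q assms(2,3) in auto)
  then obtain r where r: "vwalk r (underlying G)" "hd r = u" "last r = j" "length r < length q"
    using q(3) by auto
  have "r \<noteq> []"
    using r(1) by (auto simp: vwalk_def)
  then have "vwalk_length r < vwalk_length q"
    using r(4) by (cases r) auto
  then show ?thesis
    using graph_dist_le[OF r(1)] r(2,3) q(4) by (simp del: vwalk_length_simp)
qed

section \<open>Cycles, bridges, paths and distances in trees\<close>

context oriented_graph
begin

text \<open>The rest of the cycle bypasses its first edge.\<close>

lemma cycle_imp_not_bridges:
  assumes "is_cycle G c"
  shows "\<not> all_bridges G"
proof -
  from assms have walk: "vwalk c (underlying G)" and "hd c = last c" "distinct (tl c)" "length c \<ge> 4"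
    by (auto simp: is_cycle_def)
  then obtain x y z p where c: "c = x # y # z # p" and "p \<noteq> []"
    by (cases c rule: vwalk_arcs.cases; cases "tl (tl c)") (auto, fastforce)
  then have x: "last p = x" and dist: "distinct (y # z # p)"
    using \<open>hd c = last c\<close> \<open>distinct (tl c)\<close> by auto
  have "x \<in> set p"
    using x \<open>p \<noteq> []\<close> by auto
  then have "z \<noteq> x" "y \<noteq> x"
    using dist by auto
  obtain e where e: "e \<in> arcs G" "x = tail G e \<and> y = head G e \<or> x = head G e \<and> y = tail G e"
    using walk by (auto simp: c vwalk_underlying_iff elim: linksE)
  \<comment> \<open>\<open>y\<close> occurs only at the front of this walk and is followed by
    \<open>z\<close>, not by \<open>x\<close>; so the edge between \<open>x\<close> and
    \<open>y\<close> is used in neither direction.\<close>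
  have "set (vwalk_arcs (y # z # p)) \<subseteq> links G (arcs G - {e})"
  proof
    fix a assume a: "a \<in> set (vwalk_arcs (y # z # p))"
    then have "a \<in> links G (arcs G)"
      using walk by (auto simp: c vwalk_underlying_iff)
    moreover have "a \<noteq> (x, y)" "a \<noteq> (y, x)"
      using a dist \<open>z \<noteq> x\<close> \<open>y \<noteq> x\<close> arcs_in_vwalk_arcs[of a "z # p"] by auto
    ultimately show "a \<in> links G (arcs G - {e})"
      using e(2) links_remove[of "fst a" "snd a" G "arcs G" e] by (cases a) auto
  qed
  then have "(y, x) \<in> (links G (arcs G - {e}))\<^sup>*"
    using vwalk_arcs_reachable[of "y # z # p"] x \<open>p \<noteq> []\<close> by auto
  then have "(tail G e, head G e) \<in> (links G (arcs G - {e}))\<^sup>*"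
    using e(2) links_rtrancl_sym by metis
  then show ?thesis
    using e(1) by (auto simp: all_bridges_def)
qed

lemma oriented_graph_restrict:
  assumes "E \<subseteq> arcs G"
  shows "oriented_graph (G\<lparr>arcs := E\<rparr>)"
proof -
  have "arcs_ends (G\<lparr>arcs := E\<rparr>) \<subseteq> arcs_ends G"
    using assms by (auto simp: arcs_ends_conv)
  then have "(v, u) \<notin> arcs_ends (G\<lparr>arcs := E\<rparr>)" if "(u, v) \<in> arcs_ends (G\<lparr>arcs := E\<rparr>)" for u v
    using that no_opposite_arcs by blast
  moreover have "finite E"
    using assms finite_arcs by (rule finite_subset)
  ultimately show ?thesis
    using assms tail_neq_head no_multi_arcs
    by unfold_locales (auto simp: arc_to_ends_def subset_iff)
qed

lemma links_restrict [simp]: "links (G\<lparr>arcs := E\<rparr>) = links G"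
  by (auto simp: links_def fun_eq_iff)

text \<open>A path that joins the ends of a non-bridge \<open>e\<close> without using
  \<open>e\<close> closes up with \<open>e\<close>. It has at least three vertices, since a single
  edge would come from a second arc between the same ends.\<close>

lemma not_bridges_imp_cycle:
  assumes "\<not> all_bridges G"
  shows "\<exists>c. is_cycle G c"
proof -
  obtain e where e: "e \<in> arcs G" "(tail G e, head G e) \<in> (links G (arcs G - {e}))\<^sup>*"
    using assms by (auto simp: all_bridges_def)
  interpret D: oriented_graph "G\<lparr>arcs := arcs G - {e}\<rparr>"
    by (rule oriented_graph_restrict) auto
  obtain p where p: "vpath p (underlying (G\<lparr>arcs := arcs G - {e}\<rparr>))" "hd p = head G e" "last p = tail G e"
    using D.vpath_underlying_exists[of "head G e" "tail G e"] links_rtrancl_sym[OF e(2)] e(1)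
    by auto
  have walk: "vwalk p (underlying G)"
    using p(1) links_mono[of "arcs G - {e}" "arcs G" G] by (auto simp: vpath_def vwalk_underlying_iff)
  have len: "length p \<ge> 3"
  proof (rule ccontr)
    assume "\<not> length p \<ge> 3"
    then consider "p = []" | x where "p = [x]" | x y where "p = [x, y]"
      by (auto simp: not_le numeral_3_eq_3 less_Suc_eq length_Suc_conv)
    then show False
    proof cases
      case 1
      then show ?thesis using walk by (simp add: vwalk_def)
    next
      case 2
      then show ?thesis using p tail_neq_head[OF e(1)] by simp
    next
      case 3
      then have "(head G e, tail G e) \<in> links G (arcs G - {e})"
        using p by (auto simp: vpath_def vwalk_underlying_iff)
      then obtain f where f: "f \<in> arcs G - {e}"
        "head G e = tail G f \<and> tail G e = head G f \<or> head G e = head G f \<and> tail G e = tail G f"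
        by (rule linksE)
      then have "e = f"
        using e(1) by (intro arcs_eqI) auto
      then show ?thesis
        using f(1) by simp
    qed
  qed
  then have "p \<noteq> []" by auto
  have "vwalk (tail G e # p) (underlying G)"
    using walk e(1) p(2) by (intro vwalk_consI) (auto simp: arcs_ends_underlying links_arc)
  then have "is_cycle G (tail G e # p)"
    using p \<open>p \<noteq> []\<close> len by (auto simp: is_cycle_def vpath_def)
  then show ?thesis ..
qed

lemma acyclic_iff: "\<not> (\<exists>c. is_cycle G c) \<longleftrightarrow> all_bridges G"
  using cycle_imp_not_bridges not_bridges_imp_cycle by blast

text \<open>Where the two paths part, at \<open>x\<close> towards \<open>y\<close> and
  \<open>z\<close>, the edge from \<open>x\<close> to \<open>y\<close> is bypassed: go to
  \<open>z\<close>, on to the common end and back to \<open>y\<close>. The remainders do not meet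
  \<open>x\<close> again, so none of this uses that edge.\<close>

lemma vpath_unique:
  assumes "all_bridges G" "vpath p (underlying G)" "vpath q (underlying G)"
    "hd p = hd q" "last p = last q"
  shows "p = q"
  using assms(2-)
proof (induction p arbitrary: q rule: vwalk_arcs.induct)
  case 1
  then show ?case by (auto simp: vpath_def vwalk_def)
next
  case (2 x)
  then show ?case
    by (cases q rule: vwalk_arcs.cases) (auto simp: vpath_def vwalk_def split: if_splits)
next
  case (3 x y p)
  have "q \<noteq> [x]" "q \<noteq> []"
    using 3(2,3,5) by (auto simp: vpath_def vwalk_def split: if_splits)
  then obtain z q' where q: "q = x # z # q'"
    using 3(4) by (cases q rule: vwalk_arcs.cases) auto
  have dist: "x \<notin> set (y # p)" "x \<notin> set (z # q')"
    using 3(2,3) by (auto simp: vpath_def q)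
  have paths: "vpath (y # p) (underlying G)" "vpath (z # q') (underlying G)"
    using 3(2,3) by (auto simp: vpath_def vwalk_underlying_iff q)
  show ?case
  proof (cases "y = z")
    case True
    then show ?thesis
      using 3(1)[of "z # q'"] paths 3(5) by (simp add: q)
  next
    case False
    obtain e where e: "e \<in> arcs G" "x = tail G e \<and> y = head G e \<or> x = head G e \<and> y = tail G e"
      using 3(2) by (auto simp: vpath_def vwalk_underlying_iff elim: linksE)
    have avoid: "set (vwalk_arcs r) \<subseteq> links G (arcs G - {e})"
      if r: "set (vwalk_arcs r) \<subseteq> links G (arcs G)" "x \<notin> set r" for r
    proof
      fix a assume a: "a \<in> set (vwalk_arcs r)"
      then show "a \<in> links G (arcs G - {e})"
        using r e(2) arcs_in_vwalk_arcs[OF a] links_remove[of "fst a" "snd a" G "arcs G" e]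
        by (cases a) auto
    qed
    have "(y, last (y # p)) \<in> (links G (arcs G - {e}))\<^sup>*"
      using vwalk_arcs_reachable[OF avoid[of "y # p"]] paths(1) dist
      by (auto simp: vpath_def vwalk_underlying_iff)
    moreover have "(z, last (z # q')) \<in> (links G (arcs G - {e}))\<^sup>*"
      using vwalk_arcs_reachable[OF avoid[of "z # q'"]] paths(2) dist
      by (auto simp: vpath_def vwalk_underlying_iff)
    moreover have "(x, z) \<in> links G (arcs G - {e})"
      using 3(3) False e(2) dist
      by (intro links_remove) (auto simp: vpath_def vwalk_underlying_iff q)
    moreover have "last (y # p) = last (z # q')"
      using 3(5) by (simp add: q)
    ultimately have "(x, y) \<in> (links G (arcs G - {e}))\<^sup>*"
      by (metis converse_rtrancl_into_rtrancl links_rtrancl_sym rtrancl_trans)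
    then have "(tail G e, head G e) \<in> (links G (arcs G - {e}))\<^sup>*"
      using e(2) links_rtrancl_sym by metis
    then show ?thesis
      using assms(1) e(1) by (simp add: all_bridges_def)
  qed
qed

lemma tree_path_props:
  assumes "all_bridges G" "connected G" "j \<in> verts G" "u \<in> verts G"
  shows "vpath (tree_path G j u) (underlying G)"
    and "hd (tree_path G j u) = j" and "last (tree_path G j u) = u"
proof -
  have "(j, u) \<in> (links G (arcs G))\<^sup>*"
    using assms by (simp add: connected_iff)
  then obtain p where p: "vpath p (underlying G)" "hd p = j" "last p = u"
    using vpath_underlying_exists assms(3) by blast
  then have "\<exists>!p. vpath p (underlying G) \<and> hd p = j \<and> last p = u"
    by (intro ex1I[of _ p]) (auto intro!: vpath_unique[OF assms(1)])
  from theI'[OF this] show "vpath (tree_path G j u) (underlying G)"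
    and "hd (tree_path G j u) = j" and "last (tree_path G j u) = u"
    unfolding tree_path_def by auto
qed

text \<open>A forest has no cycles at all, so the constant weight \<open>-1\<close> satisfies the sign condition.\<close>

lemma closed_walk_even:
  assumes "all_bridges G" "vwalk c (underlying G)" "hd c = last c"
  shows "even (vwalk_length c)"
proof -
  have "walk_prod (\<lambda>_ _. - 1) c \<in> pos_reals"
    by (rule closed_walk_prod_pos) (use assms acyclic_iff in auto)
  moreover have "walk_prod (\<lambda>_ _. 1) c = 1"
    by (simp add: walk_prod_def case_prod_unfold map_replicate_const)
  ultimately have "(- 1) ^ vwalk_length c \<in> pos_reals"
    using walk_prod_uminus[of "\<lambda>_ _. 1" c] by (simp del: vwalk_length_simp)
  then show ?thesis
    by (cases "even (vwalk_length c)") (auto simp: pos_reals_iff simp del: vwalk_length_simp)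
qed

lemma walk_length_parity:
  assumes "all_bridges G" "vwalk p (underlying G)" "vwalk q (underlying G)"
    "hd q = last p" "last q = hd p"
  shows "even (vwalk_length p) \<longleftrightarrow> even (vwalk_length q)"
proof -
  have ne: "p \<noteq> []" "q \<noteq> []"
    using assms(2,3) by (auto simp: vwalk_def)
  then have join: "joinable p q"
    using assms(4) by simp
  have "vwalk (p \<oplus> q) (underlying G)" "hd (p \<oplus> q) = last (p \<oplus> q)"
    using assms ne join by (auto intro!: vwalk_joinI_vwalk simp: vwalk_join_last vwalk_join_hd)
  then have "even (vwalk_length (p \<oplus> q))"
    by (rule closed_walk_even[OF assms(1)])
  then show ?thesis
    unfolding vwalk_join_vwalk_length[OF join] by simp
qed

text \<open>Since \<open>e\<close> is the only edge between its two sides, a walk from the other end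
  of \<open>e\<close> enters the side of \<open>j\<close> through the end that lies in it; so the
  minimum is attained at that end.\<close>

lemma edge_dist_eq:
  assumes "all_bridges G" "connected G" "e \<in> arcs G" "j \<in> verts G"
  shows "j \<in> tail_side G (arcs G) e \<Longrightarrow> edge_dist G e j = graph_dist G (tail G e) j"
    and "j \<in> head_side G (arcs G) e \<Longrightarrow> edge_dist G e j = graph_dist G (head G e) j"
proof -
  have bridge: "(tail G e, head G e) \<notin> (links G (arcs G - {e}))\<^sup>*"
    using assms(1,3) by (simp add: all_bridges_def)
  have walk: "\<exists>p. vwalk p (underlying G) \<and> hd p = v \<and> last p = j" if "v \<in> verts G" for v
    using tree_path_props[OF assms(1,2) that assms(4)] by (auto simp: vpath_def)
  have ends: "tail G e \<in> verts G" "head G e \<in> verts G"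
    using assms(3) by auto
  {
    assume j: "j \<in> tail_side G (arcs G) e"
    have "head G e \<notin> tail_side G (arcs G) e"
      using bridge by (simp add: tail_side_def)
    moreover have "y = tail G e"
      if "(x, y) \<in> links G (arcs G)" "x \<notin> tail_side G (arcs G) e" "y \<in> tail_side G (arcs G) e" for x y
    proof (rule ccontr)
      assume "y \<noteq> tail G e"
      moreover have "x \<noteq> tail G e"
        using that(2) by (auto simp: tail_side_def)
      ultimately have "(y, x) \<in> links G (arcs G - {e})"
        using that(1) by (intro links_sym[of x y] links_remove) auto
      then show False
        using that(2,3) by (auto simp: tail_side_def intro: rtrancl_into_rtrancl)
    qed
    ultimately have "graph_dist G (tail G e) j < graph_dist G (head G e) j"
      using walk[OF ends(2)] j graph_dist_less_of_side[where S = "tail_side G (arcs G) e"] by metis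
    then show "edge_dist G e j = graph_dist G (tail G e) j"
      by (simp add: edge_dist_def)
  next
    assume j: "j \<in> head_side G (arcs G) e"
    have "tail G e \<notin> head_side G (arcs G) e"
      using bridge links_rtrancl_sym by (fastforce simp: head_side_def)
    moreover have "y = head G e"
      if "(x, y) \<in> links G (arcs G)" "x \<notin> head_side G (arcs G) e" "y \<in> head_side G (arcs G) e" for x y
    proof (rule ccontr)
      assume "y \<noteq> head G e"
      moreover have "x \<noteq> head G e"
        using that(2) by (auto simp: head_side_def)
      ultimately have "(y, x) \<in> links G (arcs G - {e})"
        using that(1) by (intro links_sym[of x y] links_remove) auto
      then show False
        using that(2,3) by (auto simp: head_side_def intro: rtrancl_into_rtrancl)
    qed
    ultimately have "graph_dist G (head G e) j < graph_dist G (tail G e) j"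
      using walk[OF ends(1)] j graph_dist_less_of_side[where S = "head_side G (arcs G) e"] by metis
    then show "edge_dist G e j = graph_dist G (head G e) j"
      by (simp add: edge_dist_def)
  }
qed

text \<open>The sign in the entry formula depends on this parity only. A shortest walk one way and
  the tree path back form a closed walk in a forest, which has even length.\<close>

lemma graph_dist_parity:
  assumes "all_bridges G" "connected G" "u \<in> verts G" "j \<in> verts G"
  shows "even (graph_dist G u j) \<longleftrightarrow> even (vwalk_length (tree_path G j u))"
proof -
  have p: "vwalk (tree_path G u j) (underlying G)" "hd (tree_path G u j) = u" "last (tree_path G u j) = j"
    using tree_path_props[OF assms] by (auto simp: vpath_def)
  obtain q where q: "vwalk q (underlying G)" "hd q = u" "last q = j" "vwalk_length q = graph_dist G u j"
    using graph_dist_attained[OF p(1)] p(2,3) by metis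
  show ?thesis
    using walk_length_parity[OF assms(1) q(1), of "tree_path G j u"] q
      tree_path_props[OF assms(1,2,4,3)] by (simp add: vpath_def del: vwalk_length_simp)
qed

end

section \<open>Spanning trees as arc sets\<close>

definition tree_arcs :: "('a, 'b) pre_digraph \<Rightarrow> 'b set set" where
  "tree_arcs G = {E. E \<subseteq> arcs G \<and> (\<forall>x\<in>verts G. \<forall>y\<in>verts G. (x, y) \<in> (links G E)\<^sup>*) \<and>
     (\<forall>e\<in>E. (tail G e, head G e) \<notin> (links G (E - {e}))\<^sup>*)}"

text \<open>
  The entry in row \<open>e\<close> and column \<open>j\<close> of the pseudoinverse of the incidence matrix, with entries
  1 at tails and -1 at heads, of the tree with arc set \<open>E\<close>.
\<close>

definition tree_gap :: "('a, 'b) pre_digraph \<Rightarrow> 'b set \<Rightarrow> 'b \<Rightarrow> 'a \<Rightarrow> complex" where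
  "tree_gap G E e j =
     (if j \<in> tail_side G E e then of_nat (card (head_side G E e))
      else - of_nat (card (tail_side G E e))) / of_nat (card (verts G))"

definition incidence_sign :: "('a, 'b) pre_digraph \<Rightarrow> 'a \<Rightarrow> 'b \<Rightarrow> complex" where
  "incidence_sign G i e = (if i = tail G e then 1 else if i = head G e then - 1 else 0)"

context oriented_graph
begin

lemma inj_restrict_arcs: "inj_on (\<lambda>E. G\<lparr>arcs := E\<rparr>) A"
  by (rule inj_onI) (metis pre_digraph.select_convs(2) pre_digraph.surjective pre_digraph.update_convs(2))

lemma tree_arcs_iff:
  assumes "verts G \<noteq> {}"
  shows "E \<in> tree_arcs G \<longleftrightarrow>
    E \<subseteq> arcs G \<and> connected (G\<lparr>arcs := E\<rparr>) \<and> all_bridges (G\<lparr>arcs := E\<rparr>)"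
proof (cases "E \<subseteq> arcs G")
  case True
  interpret H: oriented_graph "G\<lparr>arcs := E\<rparr>"
    by (rule oriented_graph_restrict[OF True])
  show ?thesis
    using assms True by (auto simp: tree_arcs_def H.connected_iff all_bridges_def)
qed (auto simp: tree_arcs_def)

lemma spanning_trees_eq:
  assumes "verts G \<noteq> {}"
  shows "spanning_trees G = (\<lambda>E. G\<lparr>arcs := E\<rparr>) ` tree_arcs G"
proof (intro equalityI subsetI)
  fix T assume T: "T \<in> spanning_trees G"
  then have sub: "arcs T \<subseteq> arcs G" and "T = G\<lparr>arcs := arcs T\<rparr>"
    by (auto simp: spanning_trees_def spanning_def subgraph_def compatible_def
        intro!: pre_digraph.equality)
  interpret H: oriented_graph "G\<lparr>arcs := arcs T\<rparr>"
    by (rule oriented_graph_restrict[OF sub])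
  have "connected (G\<lparr>arcs := arcs T\<rparr>)" "all_bridges (G\<lparr>arcs := arcs T\<rparr>)"
    using T \<open>T = _\<close> H.acyclic_iff by (auto simp: spanning_trees_def)
  then have "arcs T \<in> tree_arcs G"
    using sub by (simp add: tree_arcs_iff[OF assms])
  then show "T \<in> (\<lambda>E. G\<lparr>arcs := E\<rparr>) ` tree_arcs G"
    using \<open>T = _\<close> by blast
next
  fix T assume "T \<in> (\<lambda>E. G\<lparr>arcs := E\<rparr>) ` tree_arcs G"
  then obtain E where E: "E \<in> tree_arcs G" and T: "T = G\<lparr>arcs := E\<rparr>"
    by blast
  then have sub: "E \<subseteq> arcs G" and conn: "connected T" and bridges: "all_bridges T"
    by (auto simp: tree_arcs_iff[OF assms])
  interpret H: oriented_graph T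
    unfolding T by (rule oriented_graph_restrict[OF sub])
  have "wf_digraph T" "wf_digraph G"
    by unfold_locales
  then have "spanning T G"
    using sub by (auto simp: spanning_def subgraph_def compatible_def T)
  then show "T \<in> spanning_trees G"
    using conn bridges H.acyclic_iff by (simp add: spanning_trees_def)
qed

lemma finite_tree_arcs: "finite (tree_arcs G)"
  by (rule finite_subset[of _ "Pow (arcs G)"]) (auto simp: tree_arcs_def)

lemma tree_arcs_subset: "E \<in> tree_arcs G \<Longrightarrow> E \<subseteq> arcs G"
  by (simp add: tree_arcs_def)

lemma finite_tree: "E \<in> tree_arcs G \<Longrightarrow> finite E"
  using tree_arcs_subset finite_subset finite_arcs by blast

text \<open>A connecting arc set of least size is a tree: an arc that is not a bridge could be
  removed.\<close>

lemma tree_arcs_nonempty: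
  assumes "connected G"
  shows "tree_arcs G \<noteq> {}"
proof -
  define P where "P E \<longleftrightarrow> E \<subseteq> arcs G \<and> (\<forall>x\<in>verts G. \<forall>y\<in>verts G. (x, y) \<in> (links G E)\<^sup>*)" for E
  have "P (arcs G)"
    using assms by (simp add: P_def connected_iff)
  then obtain E where E: "P E" and min: "\<And>F. P F \<Longrightarrow> card E \<le> card F"
    using ex_has_least_nat[of P "arcs G" card] by blast
  have "(tail G e, head G e) \<notin> (links G (E - {e}))\<^sup>*" if e: "e \<in> E" for e
  proof
    assume cyc: "(tail G e, head G e) \<in> (links G (E - {e}))\<^sup>*"
    have "(x, y) \<in> (links G (E - {e}))\<^sup>*" if "(x, y) \<in> (links G E)\<^sup>*" for x y
      using links_rtrancl_insert[of x y G e "E - {e}"] that cyc insert_Diff[OF e]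
      by (metis links_rtrancl_sym rtrancl_trans)
    then have "P (E - {e})"
      using E by (auto simp: P_def)
    then have "card E \<le> card (E - {e})"
      by (rule min)
    moreover have "finite E"
      using E finite_subset[OF _ finite_arcs] by (auto simp: P_def)
    ultimately show False
      using card_Diff1_less[of E e] e by simp
  qed
  then have "E \<in> tree_arcs G"
    using E by (simp add: tree_arcs_def P_def)
  then show ?thesis by blast
qed

section \<open>The cut defined by a tree arc\<close>

context
  fixes E e
  assumes E: "E \<in> tree_arcs G" and e: "e \<in> E"
begin

lemma sides_disjoint: "tail_side G E e \<inter> head_side G E e = {}"
proof -
  have False if "x \<in> tail_side G E e" "x \<in> head_side G E e" for x
  proof -
    have "(tail G e, x) \<in> (links G (E - {e}))\<^sup>*" "(x, head G e) \<in> (links G (E - {e}))\<^sup>*"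
      using that links_rtrancl_sym by (auto simp: tail_side_def head_side_def)
    then have "(tail G e, head G e) \<in> (links G (E - {e}))\<^sup>*"
      by (rule rtrancl_trans)
    then show False
      using E e by (simp add: tree_arcs_def)
  qed
  then show ?thesis by blast
qed

lemma sides_cover: "tail_side G E e \<union> head_side G E e = verts G"
proof (intro equalityI subsetI)
  have sub: "E - {e} \<subseteq> arcs G" and ends: "tail G e \<in> verts G" "head G e \<in> verts G"
    using tree_arcs_subset[OF E] e by auto
  show "x \<in> verts G" if "x \<in> tail_side G E e \<union> head_side G E e" for x
    using that links_rtrancl_in_verts[OF _ _ sub] ends by (auto simp: tail_side_def head_side_def)
  show "x \<in> tail_side G E e \<union> head_side G E e" if "x \<in> verts G" for x
  proof -
    have "(tail G e, x) \<in> (links G (insert e (E - {e})))\<^sup>*"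
      using that ends E insert_Diff[OF e] by (simp add: tree_arcs_def)
    then show ?thesis
      using links_rtrancl_insert[of "tail G e" x G e "E - {e}"]
      by (auto simp: tail_side_def head_side_def)
  qed
qed

lemma finite_sides: "finite (tail_side G E e)" "finite (head_side G E e)"
  using sides_cover finite_verts by (metis finite_Un)+

lemma card_sides: "card (tail_side G E e) + card (head_side G E e) = card (verts G)"
  using card_Un_disjoint[OF finite_sides sides_disjoint] sides_cover by simp

lemma tail_in_side: "tail G e \<in> tail_side G E e" and head_in_side: "head G e \<in> head_side G E e"
  by (auto simp: tail_side_def head_side_def)

lemma ends_same_side:
  "f \<in> E \<Longrightarrow> f \<noteq> e \<Longrightarrow> tail G f \<in> tail_side G E e \<longleftrightarrow> head G f \<in> tail_side G E e"
  unfolding tail_side_def using links_arc[of f "E - {e}" G] links_arc_rev[of f "E - {e}" G]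
  by (auto intro: rtrancl_into_rtrancl)

text \<open>Each side contributes the product of the two side sizes over the number of vertices,
  with opposite signs. The constant vector is orthogonal to all columns of the incidence matrix, so
  a pseudoinverse must annihilate it.\<close>

lemma sum_tree_gap: "(\<Sum>j\<in>verts G. tree_gap G E e j) = 0"
proof -
  have "(\<Sum>j\<in>verts G. tree_gap G E e j) =
      (\<Sum>j\<in>tail_side G E e. tree_gap G E e j) + (\<Sum>j\<in>head_side G E e. tree_gap G E e j)"
    unfolding sides_cover[symmetric] by (rule sum.union_disjoint[OF finite_sides sides_disjoint])
  also have "(\<Sum>j\<in>head_side G E e. tree_gap G E e j) =
      (\<Sum>j\<in>head_side G E e. - of_nat (card (tail_side G E e)) / of_nat (card (verts G)))"
    using sides_disjoint by (intro sum.cong) (auto simp: tree_gap_def)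
  finally show ?thesis
    by (simp add: tree_gap_def)
qed

text \<open>Across the cut the gap jumps by the sum of the side sizes over the number of vertices,
  that is by 1; on each side it is constant. For \<open>f\<close> outside the tree the value tells
  whether, and in which direction, the tree path from the tail to the head of \<open>f\<close>
  passes through \<open>e\<close>.\<close>

lemma tree_gap_diff:
  assumes "f \<in> arcs G"
  shows "tree_gap G E e (tail G f) - tree_gap G E e (head G f) =
    (if tail G f \<in> tail_side G E e \<and> head G f \<in> head_side G E e then 1
     else if tail G f \<in> head_side G E e \<and> head G f \<in> tail_side G E e then - 1 else 0)"
proof -
  have in_sides: "x \<in> head_side G E e \<longleftrightarrow> x \<notin> tail_side G E e" if "x \<in> verts G" for x
    using that sides_cover sides_disjoint by blast
  have "card (verts G) \<noteq> 0"
    using assms tail_in_verts finite_verts by (metis card_eq_0_iff empty_iff)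
  then have "of_nat (card (verts G)) / of_nat (card (verts G)) = (1 :: complex)"
    by simp
  then have one: "of_nat (card (tail_side G E e)) / of_nat (card (verts G)) +
      of_nat (card (head_side G E e)) / of_nat (card (verts G)) = (1 :: complex)"
    unfolding add_divide_distrib[symmetric] of_nat_add[symmetric] card_sides .
  then have one': "of_nat (card (head_side G E e)) / of_nat (card (verts G)) +
      of_nat (card (tail_side G E e)) / of_nat (card (verts G)) = (1 :: complex)"
    by (simp add: add.commute)
  have "- a - b = - 1" if "a + b = 1" for a b :: complex
    using that by (simp add: algebra_simps add_eq_0_iff)
  from this[OF one] show ?thesis
    using assms one' by (auto simp: in_sides tree_gap_def)
qed

end

lemma sum_incidence_sign:
  assumes "e \<in> arcs G"
  shows "(\<Sum>i\<in>verts G. g i * incidence_sign G i e) = g (tail G e) - g (head G e)"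
proof -
  have "(\<Sum>i\<in>verts G. g i * incidence_sign G i e) = (\<Sum>i\<in>{tail G e, head G e}. g i * incidence_sign G i e)"
    using assms by (intro sum.mono_neutral_right) (auto simp: incidence_sign_def)
  then show ?thesis
    using tail_neq_head[OF assms] by (simp add: incidence_sign_def)
qed

text \<open>Among the tree arcs only \<open>e\<close> crosses its own cut; every other one has both
  ends on the same side.\<close>

lemma tree_gap_left_inverse:
  assumes E: "E \<in> tree_arcs G" and "e \<in> E" "f \<in> E"
  shows "(\<Sum>j\<in>verts G. tree_gap G E e j * incidence_sign G j f) = (if e = f then 1 else 0)"
proof -
  have f: "f \<in> arcs G"
    using tree_arcs_subset[OF E] \<open>f \<in> E\<close> by blast
  show ?thesis
  proof (cases "e = f")
    case True
    then show ?thesis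
      using tail_in_side[of E e] head_in_side[of E e] assms
      by (simp add: sum_incidence_sign[OF f] tree_gap_diff[OF E _ f])
  next
    case False
    then show ?thesis
      using ends_same_side[OF E \<open>e \<in> E\<close> \<open>f \<in> E\<close>] sides_disjoint[OF E \<open>e \<in> E\<close>]
      by (auto simp: sum_incidence_sign[OF f] tree_gap_diff[OF E \<open>e \<in> E\<close> f])
  qed
qed

text \<open>
  The product fixes every column of the incidence matrix, hence all differences of unit vectors,
  and its rows sum to 0; these two facts determine it.
\<close>

lemma tree_gap_right_inverse:
  assumes E: "E \<in> tree_arcs G" and i: "i \<in> verts G" and j: "j \<in> verts G"
  shows "(\<Sum>e\<in>E. incidence_sign G i e * tree_gap G E e j) =
    (if i = j then 1 else 0) - 1 / of_nat (card (verts G))"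
proof -
  define c where "c j = (\<Sum>e\<in>E. incidence_sign G i e * tree_gap G E e j)" for j
  define d where "d j = c j - (if i = j then 1 else 0)" for j
  have d_arc: "d (tail G f) = d (head G f)" if f: "f \<in> E" for f
  proof -
    have fG: "f \<in> arcs G"
      using f tree_arcs_subset[OF E] by blast
    have "(\<Sum>j\<in>verts G. c j * incidence_sign G j f) =
        (\<Sum>e\<in>E. incidence_sign G i e * (\<Sum>j\<in>verts G. tree_gap G E e j * incidence_sign G j f))"
      unfolding c_def sum_distrib_right sum_distrib_left
      by (subst sum.swap) (simp add: mult.assoc)
    also have "\<dots> = (\<Sum>e\<in>E. if e = f then incidence_sign G i e else 0)"
      using E f by (intro sum.cong) (auto simp: tree_gap_left_inverse)
    also have "\<dots> = incidence_sign G i f"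
      using f finite_tree[OF E] by simp
    finally have "c (tail G f) - c (head G f) = incidence_sign G i f"
      unfolding sum_incidence_sign[OF fG] .
    then show ?thesis
      using tail_neq_head[OF fG] by (auto simp: d_def incidence_sign_def algebra_simps split: if_splits)
  qed
  have d_const: "d x = d y" if "(x, y) \<in> (links G E)\<^sup>*" for x y
    using that by (induction rule: rtrancl_induct) (auto elim!: linksE simp: d_arc)
  have "d x = d j" if "x \<in> verts G" for x
    using E j that by (intro d_const) (simp add: tree_arcs_def)
  then have "of_nat (card (verts G)) * d j = (\<Sum>x\<in>verts G. d x)"
    by simp
  also have "\<dots> = (\<Sum>e\<in>E. incidence_sign G i e * (\<Sum>x\<in>verts G. tree_gap G E e x)) - 1"
    unfolding d_def c_def sum_subtractf sum_distrib_left using i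
    by (subst sum.swap) simp
  also have "\<dots> = - 1"
    using sum_tree_gap[OF E] by simp
  finally have "of_nat (card (verts G)) * d j = - 1" .
  then have "d j = - 1 / of_nat (card (verts G))"
    by (metis mult_zero_left nonzero_mult_div_cancel_left zero_neq_neg_one)
  then show ?thesis
    by (simp add: d_def c_def algebra_simps)
qed

text \<open>An arc \<open>f\<close> across the cut of \<open>e\<close> reconnects the two sides, and
  it is a bridge of the new set because it joins different components of \<open>E - {e}\<close>. A
  detour around another arc \<open>g\<close> would have to use \<open>f\<close>; together with
  \<open>g\<close> it would then connect the ends of \<open>f\<close> within
  \<open>E - {e}\<close>.\<close>

lemma tree_exchange:
  assumes E: "E \<in> tree_arcs G" and e: "e \<in> E" and f: "f \<in> arcs G" "f \<notin> E"
    and cross: "tail G f \<in> tail_side G E e \<and> head G f \<in> head_side G E e \<or>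
      tail G f \<in> head_side G E e \<and> head G f \<in> tail_side G E e"
  shows "insert f (E - {e}) \<in> tree_arcs G"
proof -
  let ?D = "E - {e}"
  have ef: "(tail G e, tail G f) \<in> (links G ?D)\<^sup>* \<and> (head G f, head G e) \<in> (links G ?D)\<^sup>* \<or>
      (tail G e, head G f) \<in> (links G ?D)\<^sup>* \<and> (tail G f, head G e) \<in> (links G ?D)\<^sup>*"
    using cross links_rtrancl_sym by (fastforce simp: tail_side_def head_side_def)
  have ends_e: "(tail G e, head G e) \<in> (links G (insert f ?D))\<^sup>*"
    using ef links_rtrancl_mono[of ?D "insert f ?D"] links_arc[of f "insert f ?D" G]
      links_arc_rev[of f "insert f ?D" G]
    by (meson insertI1 r_into_rtrancl rtrancl_trans subset_insertI)
  have conn: "(x, y) \<in> (links G (insert f ?D))\<^sup>*" if "x \<in> verts G" "y \<in> verts G" for x y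
  proof -
    have "(x, y) \<in> (links G (insert e ?D))\<^sup>*"
      using E that insert_Diff[OF e] by (simp add: tree_arcs_def)
    then show ?thesis
      using links_rtrancl_insert[of x y G e ?D] links_rtrancl_mono[of ?D "insert f ?D"] ends_e
      by (meson links_rtrancl_sym rtrancl_trans subset_insertI)
  qed
  have bridge_e: "(tail G e, head G e) \<notin> (links G ?D)\<^sup>*"
    using E e by (simp add: tree_arcs_def)
  have bridge_f: "(tail G f, head G f) \<notin> (links G ?D)\<^sup>*"
    using ef bridge_e by (meson links_rtrancl_sym rtrancl_trans)
  have "(tail G g, head G g) \<notin> (links G (insert f ?D - {g}))\<^sup>*" if g: "g \<in> insert f ?D" for g
  proof (cases "g = f")
    case True
    then show ?thesis
      using bridge_f f(2) by simp
  next
    case False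
    then have gD: "g \<in> ?D" using g by simp
    have eq: "insert f ?D - {g} = insert f (?D - {g})"
      using False by auto
    have "(tail G g, head G g) \<notin> (links G (E - {g}))\<^sup>*"
      using E gD by (simp add: tree_arcs_def)
    moreover have "?D - {g} \<subseteq> E - {g}"
      by auto
    ultimately have "(tail G g, head G g) \<notin> (links G (?D - {g}))\<^sup>*"
      using links_rtrancl_mono by metis
    moreover have "(x, y) \<in> (links G (?D - {g}))\<^sup>* \<Longrightarrow> (x, y) \<in> (links G ?D)\<^sup>*" for x y
      by (rule links_rtrancl_mono) auto
    moreover have "(tail G g, head G g) \<in> (links G ?D)\<^sup>*"
      using links_arc[OF gD] by blast
    ultimately show ?thesis
      using links_rtrancl_insert[of "tail G g" "head G g" G f "?D - {g}"] bridge_f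
      unfolding eq by (meson links_rtrancl_sym rtrancl_trans)
  qed
  then show ?thesis
    using conn tree_arcs_subset[OF E] f(1) by (auto simp: tree_arcs_def)
qed

text \<open>
  The two sides of \<open>f\<close> in \<open>E - e + f\<close> are those of \<open>e\<close> in \<open>E\<close>, possibly interchanged: deleting the
  respective arc leaves the same forest.
\<close>

lemma tree_gap_exchange:
  assumes E: "E \<in> tree_arcs G" and e: "e \<in> E" and f: "f \<in> arcs G" "f \<notin> E"
    and nz: "tree_gap G E e (tail G f) - tree_gap G E e (head G f) \<noteq> 0"
  defines "F \<equiv> insert f (E - {e})"
  shows "F \<in> tree_arcs G"
    and "tree_gap G F f (tail G e) - tree_gap G F f (head G e) =
      tree_gap G E e (tail G f) - tree_gap G E e (head G f)"
proof -
  have eG: "e \<in> arcs G"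
    using tree_arcs_subset[OF E] e by blast
  note diff_E = tree_gap_diff[OF E e f(1)]
  have cross: "tail G f \<in> tail_side G E e \<and> head G f \<in> head_side G E e \<or>
      tail G f \<in> head_side G E e \<and> head G f \<in> tail_side G E e"
    using nz unfolding diff_E by presburger
  show F: "F \<in> tree_arcs G"
    unfolding F_def using E e f cross by (rule tree_exchange)
  have fF: "f \<in> F" by (simp add: F_def)
  have FD: "F - {f} = E - {e}"
    using f(2) by (auto simp: F_def)
  have "tail G e \<in> tail_side G F f \<longleftrightarrow> tail G f \<in> tail_side G E e"
    "tail G e \<in> head_side G F f \<longleftrightarrow> head G f \<in> tail_side G E e"
    "head G e \<in> tail_side G F f \<longleftrightarrow> tail G f \<in> head_side G E e"
    "head G e \<in> head_side G F f \<longleftrightarrow> head G f \<in> head_side G E e"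
    using links_rtrancl_sym by (auto simp: tail_side_def head_side_def FD)
  then show "tree_gap G F f (tail G e) - tree_gap G F f (head G e) =
      tree_gap G E e (tail G f) - tree_gap G E e (head G f)"
    unfolding diff_E tree_gap_diff[OF F fF eG]
    using sides_disjoint[OF E e] by auto
qed

end

section \<open>The gauged incidence matrix\<close>

definition gauged_incidence ::
    "('a, 'b) pre_digraph \<Rightarrow> ('a \<Rightarrow> complex) \<Rightarrow> ('b \<Rightarrow> complex) \<Rightarrow> 'a \<Rightarrow> 'b \<Rightarrow> complex" where
  "gauged_incidence G z c i e = z i * c e * incidence_sign G i e"

definition tree_pinv ::
    "('a, 'b) pre_digraph \<Rightarrow> ('a \<Rightarrow> complex) \<Rightarrow> ('b \<Rightarrow> complex) \<Rightarrow> 'b set \<Rightarrow> 'b \<Rightarrow> 'a \<Rightarrow> complex" where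
  "tree_pinv G z c E e j = tree_gap G E e j * cnj (z j) / c e"

text \<open>For unit \<open>z\<close> this is the identity minus \<open>z z*\<close> over the number
  of vertices: the orthogonal projection along the kernel of \<open>N*\<close> for a connected
  graph.\<close>

definition gauged_projection ::
    "('a, 'b) pre_digraph \<Rightarrow> ('a \<Rightarrow> complex) \<Rightarrow> 'a \<Rightarrow> 'a \<Rightarrow> complex" where
  "gauged_projection G z i j =
     z i * ((if i = j then 1 else 0) - 1 / of_nat (card (verts G))) * cnj (z j)"

definition tree_weight :: "('b \<Rightarrow> complex) \<Rightarrow> 'b set \<Rightarrow> real" where
  "tree_weight c E = (\<Prod>e\<in>E. (cmod (c e))\<^sup>2)"

text \<open>A tree pseudoinverse is padded with zero rows for the arcs outside the tree. So row
  \<open>e\<close> collects only the trees through \<open>e\<close>, while the normalisation runs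
  over all trees.\<close>

definition average_pinv ::
    "('a, 'b) pre_digraph \<Rightarrow> ('a \<Rightarrow> complex) \<Rightarrow> ('b \<Rightarrow> complex) \<Rightarrow> 'b \<Rightarrow> 'a \<Rightarrow> complex" where
  "average_pinv G z c e j =
     (\<Sum>E | E \<in> tree_arcs G \<and> e \<in> E. of_real (tree_weight c E) * tree_pinv G z c E e j) /
     of_real (\<Sum>E\<in>tree_arcs G. tree_weight c E)"

lemma cnj_tree_gap [simp]: "cnj (tree_gap G E e j) = tree_gap G E e j"
  by (simp add: tree_gap_def)

text \<open>The averaging works for every nonzero column scaling \<open>c\<close>; its relation to
  the edge weights enters in \<open>gauged_weights\<close>.\<close>

locale gauged_graph = oriented_graph +
  fixes z :: "'a \<Rightarrow> complex" and c :: "'b \<Rightarrow> complex"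
  assumes conn: "connected G"
    and z_unit: "i \<in> verts G \<Longrightarrow> cmod (z i) = 1"
    and c_nonzero: "e \<in> arcs G \<Longrightarrow> c e \<noteq> 0"
begin

lemma z_cnj: "i \<in> verts G \<Longrightarrow> z i * cnj (z i) = 1" "i \<in> verts G \<Longrightarrow> cnj (z i) * z i = 1"
  using z_unit by (simp_all add: complex_norm_square[symmetric] mult.commute[of "cnj _"])

lemma gauged_incidence_tree_pinv:
  assumes E: "E \<in> tree_arcs G" and i: "i \<in> verts G" and j: "j \<in> verts G"
  shows "(\<Sum>e\<in>E. gauged_incidence G z c i e * tree_pinv G z c E e j) = gauged_projection G z i j"
proof -
  have "(\<Sum>e\<in>E. gauged_incidence G z c i e * tree_pinv G z c E e j) =
      (\<Sum>e\<in>E. z i * (incidence_sign G i e * tree_gap G E e j) * cnj (z j))"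
    using tree_arcs_subset[OF E] c_nonzero
    by (intro sum.cong) (auto simp: gauged_incidence_def tree_pinv_def)
  then show ?thesis
    by (simp add: gauged_projection_def sum_distrib_left[symmetric] sum_distrib_right[symmetric]
        tree_gap_right_inverse[OF E i j])
qed

text \<open>The vertex phases cancel. Allowing \<open>f\<close> outside \<open>E\<close> yields the
  off-tree entries of \<open>X N\<close>, on which hermiticity of the average depends.\<close>

lemma tree_pinv_gauged_incidence:
  assumes "e \<in> E" and f: "f \<in> arcs G"
  shows "(\<Sum>j\<in>verts G. tree_pinv G z c E e j * gauged_incidence G z c j f) =
    c f / c e * (tree_gap G E e (tail G f) - tree_gap G E e (head G f))"
proof -
  have "(\<Sum>j\<in>verts G. tree_pinv G z c E e j * gauged_incidence G z c j f) =
      (\<Sum>j\<in>verts G. c f / c e * (tree_gap G E e j * incidence_sign G j f))"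
  proof (rule sum.cong)
    fix j assume "j \<in> verts G"
    then have "tree_pinv G z c E e j * gauged_incidence G z c j f =
        (cnj (z j) * z j) * (c f / c e * (tree_gap G E e j * incidence_sign G j f))"
      by (simp add: tree_pinv_def gauged_incidence_def)
    then show "tree_pinv G z c E e j * gauged_incidence G z c j f =
        c f / c e * (tree_gap G E e j * incidence_sign G j f)"
      using z_cnj(2)[OF \<open>j \<in> verts G\<close>] by simp
  qed simp
  then show ?thesis
    by (simp only: sum_distrib_left[symmetric] sum_incidence_sign[OF f])
qed

text \<open>\<open>X N\<close> is the identity on the tree arcs and \<open>N X\<close> is the
  hermitian projection; all four equations follow from these two products.\<close>

lemma tree_pinv_is_mp_inverse:
  assumes E: "E \<in> tree_arcs G"
  shows "is_mp_inverse (verts G) E (gauged_incidence G z c) (tree_pinv G z c E)"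
proof -
  let ?N = "gauged_incidence G z c" and ?X = "tree_pinv G z c E"
  let ?I = "\<lambda>e f. if e = f then 1 else 0 :: complex"
  have NX: "mat_eq_on (verts G) (verts G) (mat_mult E ?N ?X) (gauged_projection G z)"
    by (simp add: mat_eq_on_def mat_mult_def gauged_incidence_tree_pinv[OF E])
  have XN: "mat_eq_on E E (mat_mult (verts G) ?X ?N) ?I"
  proof (unfold mat_eq_on_def, intro ballI)
    fix e f assume e: "e \<in> E" and f: "f \<in> E"
    have fG: "f \<in> arcs G"
      using f tree_arcs_subset[OF E] by blast
    show "mat_mult (verts G) ?X ?N e f = ?I e f"
      using tree_gap_left_inverse[OF E e f] c_nonzero[OF fG]
      by (auto simp: mat_mult_def tree_pinv_gauged_incidence[OF e fG] sum_incidence_sign[OF fG])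
  qed
  have "mat_eq_on (verts G) E (mat_mult E ?N (mat_mult (verts G) ?X ?N)) (mat_mult E ?N ?I)"
    by (intro mat_eq_on_mult mat_eq_on_refl XN)
  moreover have "mat_eq_on (verts G) E (mat_mult E ?N ?I) ?N"
    using finite_tree[OF E] by (simp add: mat_eq_on_def mat_mult_def if_distrib cong: if_cong)
  moreover have "mat_eq_on E (verts G) (mat_mult E (mat_mult (verts G) ?X ?N) ?X) (mat_mult E ?I ?X)"
    by (intro mat_eq_on_mult mat_eq_on_refl XN)
  moreover have "mat_eq_on E (verts G) (mat_mult E ?I ?X) ?X"
    using finite_tree[OF E] by (simp add: mat_eq_on_def mat_mult_def if_distrib[of "\<lambda>a. a * _"] cong: if_cong)
  moreover have "mat_eq_on (verts G) (verts G) (conj_transpose (gauged_projection G z)) (gauged_projection G z)"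
    by (simp add: mat_eq_on_def conj_transpose_def gauged_projection_def)
  moreover have "mat_eq_on E E (conj_transpose ?I) ?I"
    by (simp add: mat_eq_on_def conj_transpose_def)
  ultimately show ?thesis
    using NX XN NX[THEN mat_eq_on_conj_transpose] XN[THEN mat_eq_on_conj_transpose]
    unfolding is_mp_inverse_def mat_mult_assoc
    by (meson mat_eq_on_sym mat_eq_on_trans)
qed

section \<open>The weighted average over spanning trees\<close>

lemma tree_weight_pos: "E \<in> tree_arcs G \<Longrightarrow> tree_weight c E > 0"
  using tree_arcs_subset c_nonzero unfolding tree_weight_def by (intro prod_pos) auto

lemma total_tree_weight_pos: "(\<Sum>E\<in>tree_arcs G. tree_weight c E) > 0"
  using finite_tree_arcs tree_arcs_nonempty[OF conn] tree_weight_pos by (intro sum_pos) auto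

lemma tree_weight_exchange:
  assumes E: "E \<in> tree_arcs G" and "e \<in> E" "f \<notin> E"
  shows "tree_weight c (insert f (E - {e})) * (cmod (c e))\<^sup>2 = tree_weight c E * (cmod (c f))\<^sup>2"
  using assms finite_tree[OF E] prod.remove[of E e "\<lambda>e. (cmod (c e))\<^sup>2"]
  by (simp add: tree_weight_def)

lemma sum_trees_swap:
  "(\<Sum>e\<in>arcs G. \<Sum>E | E \<in> tree_arcs G \<and> e \<in> E. g E e) = (\<Sum>E\<in>tree_arcs G. \<Sum>e\<in>E. g E e)"
proof -
  have "(\<Sum>e\<in>arcs G. \<Sum>E | E \<in> tree_arcs G \<and> e \<in> E. g E e) =
      (\<Sum>E\<in>tree_arcs G. \<Sum>e | e \<in> arcs G \<and> e \<in> E. g E e)"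
    by (rule sum.swap_restrict) (use finite_tree_arcs in auto)
  also have "\<dots> = (\<Sum>E\<in>tree_arcs G. \<Sum>e\<in>E. g E e)"
    using tree_arcs_subset by (intro sum.cong) auto
  finally show ?thesis .
qed

text \<open>Every tree yields the same projection, and the normalised weights sum to 1.\<close>

lemma gauged_incidence_average_pinv:
  "mat_eq_on (verts G) (verts G) (mat_mult (arcs G) (gauged_incidence G z c) (average_pinv G z c))
    (gauged_projection G z)"
proof (unfold mat_eq_on_def, intro ballI)
  fix i j assume i: "i \<in> verts G" and j: "j \<in> verts G"
  let ?S = "\<Sum>E\<in>tree_arcs G. tree_weight c E"
  have "mat_mult (arcs G) (gauged_incidence G z c) (average_pinv G z c) i j =
      (\<Sum>e\<in>arcs G. \<Sum>E | E \<in> tree_arcs G \<and> e \<in> E.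
        of_real (tree_weight c E) * (gauged_incidence G z c i e * tree_pinv G z c E e j)) / of_real ?S"
    by (simp add: mat_mult_def average_pinv_def sum_distrib_left sum_divide_distrib mult_ac)
  also have "\<dots> = (\<Sum>E\<in>tree_arcs G. of_real (tree_weight c E) *
      (\<Sum>e\<in>E. gauged_incidence G z c i e * tree_pinv G z c E e j)) / of_real ?S"
    by (simp add: sum_trees_swap sum_distrib_left)
  also have "\<dots> = (\<Sum>E\<in>tree_arcs G. of_real (tree_weight c E) * gauged_projection G z i j) / of_real ?S"
    using i j by (simp add: gauged_incidence_tree_pinv)
  also have "\<dots> = of_real ?S * gauged_projection G z i j / of_real ?S"
    by (simp add: sum_distrib_right)
  also have "\<dots> = gauged_projection G z i j"
    using total_tree_weight_pos by (simp del: of_real_sum)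
  finally show "mat_mult (arcs G) (gauged_incidence G z c) (average_pinv G z c) i j = gauged_projection G z i j" .
qed

text \<open>With the vertex phases removed, each column of \<open>N\<close> sums to 0, so the
  constant term of the projection drops out.\<close>

lemma gauged_projection_incidence:
  "mat_eq_on (verts G) (arcs G) (mat_mult (verts G) (gauged_projection G z) (gauged_incidence G z c))
    (gauged_incidence G z c)"
proof (unfold mat_eq_on_def, intro ballI)
  fix i f assume i: "i \<in> verts G" and f: "f \<in> arcs G"
  let ?d = "\<lambda>j. (if i = j then 1 else 0) - 1 / of_nat (card (verts G)) :: complex"
  have "mat_mult (verts G) (gauged_projection G z) (gauged_incidence G z c) i f =
      (\<Sum>j\<in>verts G. z i * c f * (?d j * incidence_sign G j f))"
    unfolding mat_mult_def
  proof (rule sum.cong)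
    fix j assume "j \<in> verts G"
    have "gauged_projection G z i j * gauged_incidence G z c j f =
        (cnj (z j) * z j) * (z i * c f * (?d j * incidence_sign G j f))"
      by (simp add: gauged_projection_def gauged_incidence_def mult_ac)
    then show "gauged_projection G z i j * gauged_incidence G z c j f =
        z i * c f * (?d j * incidence_sign G j f)"
      using z_cnj(2)[OF \<open>j \<in> verts G\<close>] by simp
  qed simp
  also have "\<dots> = z i * c f * (?d (tail G f) - ?d (head G f))"
    by (simp only: sum_distrib_left[symmetric] sum_incidence_sign[OF f])
  also have "\<dots> = gauged_incidence G z c i f"
    using tail_neq_head[OF f] by (auto simp: gauged_incidence_def incidence_sign_def)
  finally show "mat_mult (verts G) (gauged_projection G z) (gauged_incidence G z c) i f =
      gauged_incidence G z c i f" .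
qed

lemma tree_pinv_projection:
  assumes E: "E \<in> tree_arcs G" and e: "e \<in> E" and j: "j \<in> verts G"
  shows "(\<Sum>i\<in>verts G. tree_pinv G z c E e i * gauged_projection G z i j) = tree_pinv G z c E e j"
proof -
  let ?N = "gauged_incidence G z c" and ?X = "tree_pinv G z c E"
  have "mat_mult (verts G) ?X (mat_mult E ?N ?X) e j = ?X e j"
    using tree_pinv_is_mp_inverse[OF E] e j
    unfolding is_mp_inverse_def mat_mult_assoc by (simp add: mat_eq_on_def)
  then show ?thesis
    using gauged_incidence_tree_pinv[OF E _ j] by (simp add: mat_mult_def)
qed

text \<open>This is the equation \<open>X N X = X\<close> of the single trees, which share the
  projection \<open>N X\<close>.\<close>

lemma average_pinv_projection:
  "mat_eq_on (arcs G) (verts G) (mat_mult (verts G) (average_pinv G z c) (gauged_projection G z))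
    (average_pinv G z c)"
proof (unfold mat_eq_on_def, intro ballI)
  fix e j assume e: "e \<in> arcs G" and j: "j \<in> verts G"
  let ?S = "\<Sum>E\<in>tree_arcs G. tree_weight c E"
  have "mat_mult (verts G) (average_pinv G z c) (gauged_projection G z) e j =
      (\<Sum>i\<in>verts G. \<Sum>E | E \<in> tree_arcs G \<and> e \<in> E.
        of_real (tree_weight c E) * (tree_pinv G z c E e i * gauged_projection G z i j)) / of_real ?S"
    by (simp add: mat_mult_def average_pinv_def sum_distrib_left sum_distrib_right sum_divide_distrib mult_ac)
  also have "\<dots> = (\<Sum>E | E \<in> tree_arcs G \<and> e \<in> E. of_real (tree_weight c E) *
        (\<Sum>i\<in>verts G. tree_pinv G z c E e i * gauged_projection G z i j)) / of_real ?S"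
    by (subst sum.swap) (simp add: sum_distrib_left)
  also have "\<dots> = average_pinv G z c e j"
    using j by (simp add: average_pinv_def tree_pinv_projection)
  finally show "mat_mult (verts G) (average_pinv G z c) (gauged_projection G z) e j = average_pinv G z c e j" .
qed

text \<open>
  Exchanging \<open>e\<close> for \<open>f\<close> is a bijection between the spanning trees that contribute to the entry
  \<open>(e, f)\<close> and those that contribute to the entry \<open>(f, e)\<close>.
\<close>

lemma average_pinv_incidence_hermitian:
  "mat_eq_on (arcs G) (arcs G)
    (conj_transpose (mat_mult (verts G) (average_pinv G z c) (gauged_incidence G z c)))
    (mat_mult (verts G) (average_pinv G z c) (gauged_incidence G z c))"
proof (unfold mat_eq_on_def conj_transpose_def, intro ballI)
  fix f e assume f: "f \<in> arcs G" and e: "e \<in> arcs G"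
  let ?S = "\<Sum>E\<in>tree_arcs G. tree_weight c E"
  let ?gap = "\<lambda>E e f. tree_gap G E e (tail G f) - tree_gap G E e (head G f)"
  let ?A = "\<lambda>e f. {E. (E \<in> tree_arcs G \<and> e \<in> E) \<and> f \<notin> E \<and> ?gap E e f \<noteq> 0}"
  let ?t = "\<lambda>E e f. of_real (tree_weight c E) * (c f / c e * ?gap E e f)"
  have entry: "mat_mult (verts G) (average_pinv G z c) (gauged_incidence G z c) e f =
      (\<Sum>E | E \<in> tree_arcs G \<and> e \<in> E. ?t E e f) / of_real ?S"
    if "f \<in> arcs G" for e f
  proof -
    have "mat_mult (verts G) (average_pinv G z c) (gauged_incidence G z c) e f =
        (\<Sum>j\<in>verts G. \<Sum>E | E \<in> tree_arcs G \<and> e \<in> E.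
          of_real (tree_weight c E) * (tree_pinv G z c E e j * gauged_incidence G z c j f)) / of_real ?S"
      by (simp add: mat_mult_def average_pinv_def sum_distrib_left sum_distrib_right sum_divide_distrib mult_ac)
    also have "\<dots> = (\<Sum>E | E \<in> tree_arcs G \<and> e \<in> E. of_real (tree_weight c E) *
        (\<Sum>j\<in>verts G. tree_pinv G z c E e j * gauged_incidence G z c j f)) / of_real ?S"
      by (subst sum.swap) (simp add: sum_distrib_left)
    also have "\<dots> = (\<Sum>E | E \<in> tree_arcs G \<and> e \<in> E. ?t E e f) / of_real ?S"
      by (intro arg_cong2[where f = "(/)"] sum.cong refl) (use that in \<open>auto simp: tree_pinv_gauged_incidence\<close>)
    finally show ?thesis .
  qed
  have "(\<Sum>E | E \<in> tree_arcs G \<and> e \<in> E. cnj (?t E e f)) = (\<Sum>E | E \<in> tree_arcs G \<and> f \<in> E. ?t E f e)"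
  proof (cases "e = f")
    case True
    then show ?thesis
      using c_nonzero[OF f] by simp
  next
    case False
    \<comment> \<open>A tree that contains both \<open>e\<close> and \<open>f\<close> contributes
      nothing when \<open>e \<noteq> f\<close>, by the left inverse property. The trees that remain
      are those in which \<open>e\<close> can be exchanged for \<open>f\<close>.\<close>
    have support: "(\<Sum>E | E \<in> tree_arcs G \<and> e \<in> E. g E * ?gap E e f) = (\<Sum>E\<in>?A e f. g E * ?gap E e f)"
      if "e \<noteq> f" "f \<in> arcs G" for g :: "'b set \<Rightarrow> complex" and e f
    proof (rule sum.mono_neutral_right)
      show "finite {E. E \<in> tree_arcs G \<and> e \<in> E}"
        using finite_tree_arcs by simp
      show "\<forall>E\<in>{E. E \<in> tree_arcs G \<and> e \<in> E} - ?A e f. g E * ?gap E e f = 0"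
        using that tree_gap_left_inverse[of _ e f, unfolded sum_incidence_sign[OF that(2)]] by auto
    qed auto
    have step: "insert f (E - {e}) \<in> ?A f e" "insert e (insert f (E - {e}) - {f}) = E"
      "?gap (insert f (E - {e})) f e = ?gap E e f"
      if "E \<in> ?A e f" "e \<noteq> f" "f \<in> arcs G" for E e f
      using that tree_gap_exchange[of E e f] by auto
    have "(\<Sum>E | E \<in> tree_arcs G \<and> e \<in> E. cnj (?t E e f)) =
        (\<Sum>E\<in>?A e f. of_real (tree_weight c E) * cnj (c f / c e) * ?gap E e f)"
      using support[OF False f, of "\<lambda>E. of_real (tree_weight c E) * cnj (c f / c e)"]
      by (simp add: mult.assoc)
    also have "\<dots> = (\<Sum>F\<in>?A f e. of_real (tree_weight c F) * (c e / c f) * ?gap F f e)"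
    proof (rule sum.reindex_bij_witness[where i = "\<lambda>F. insert e (F - {f})" and j = "\<lambda>E. insert f (E - {e})"])
      fix E assume E: "E \<in> ?A e f"
      show "insert e (insert f (E - {e}) - {f}) = E" "insert f (E - {e}) \<in> ?A f e"
        using step[OF E False f] by auto
      \<comment> \<open>The exchange multiplies the tree weight by \<open>|c f|^2 / |c e|^2\<close>,
        precisely the factor that turns \<open>c e / c f\<close> into
        \<open>cnj (c f / c e)\<close>.\<close>
      have "of_real (tree_weight c (insert f (E - {e}))) * (c e * cnj (c e)) =
          of_real (tree_weight c E) * (c f * cnj (c f))"
        using tree_weight_exchange[of E e f] E
        unfolding complex_norm_square[symmetric] of_real_mult[symmetric] of_real_power[symmetric]
        by simp
      then have "of_real (tree_weight c (insert f (E - {e}))) * (c e / c f) =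
          of_real (tree_weight c E) * cnj (c f / c e)"
        using c_nonzero[OF e] c_nonzero[OF f] by (simp add: field_simps)
      then show "of_real (tree_weight c (insert f (E - {e}))) * (c e / c f) * ?gap (insert f (E - {e})) f e =
          of_real (tree_weight c E) * cnj (c f / c e) * ?gap E e f"
        using step(3)[OF E False f] by simp
    next
      fix F assume F: "F \<in> ?A f e"
      show "insert f (insert e (F - {f}) - {e}) = F" "insert e (F - {f}) \<in> ?A e f"
        using step[OF F False[symmetric] e] by auto
    qed
    also have "\<dots> = (\<Sum>E | E \<in> tree_arcs G \<and> f \<in> E. ?t E f e)"
      using support[OF False[symmetric] e, of "\<lambda>E. of_real (tree_weight c E) * (c e / c f)"]
      by (simp add: mult.assoc)
    finally show ?thesis .
  qed
  then show "cnj (mat_mult (verts G) (average_pinv G z c) (gauged_incidence G z c) e f) =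
      mat_mult (verts G) (average_pinv G z c) (gauged_incidence G z c) f e"
    unfolding entry[OF f] entry[OF e] by simp
qed

lemma average_pinv_gram:
  "is_mp_inverse (verts G) (verts G)
    (mat_mult (arcs G) (gauged_incidence G z c) (conj_transpose (gauged_incidence G z c)))
    (mat_mult (arcs G) (conj_transpose (average_pinv G z c)) (average_pinv G z c))"
proof (rule is_mp_inverse_gram)
  show "mat_eq_on (verts G) (verts G) (conj_transpose (gauged_projection G z)) (gauged_projection G z)"
    by (simp add: mat_eq_on_def conj_transpose_def gauged_projection_def)
qed (rule gauged_incidence_average_pinv gauged_projection_incidence average_pinv_projection
    average_pinv_incidence_hermitian)+

end

section \<open>The signless matrices in the gauge\<close>

context oriented_graph
begin

lemma adjacency_arc:
  assumes "e \<in> arcs G"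
  shows "adjacency G w (tail G e) (head G e) = edge_weight G w e"
    and "adjacency G w (head G e) (tail G e) = cnj (edge_weight G w e)"
proof -
  have "(tail G e, head G e) \<in> arcs_ends G"
    using assms by (auto simp: arcs_ends_conv)
  then show "adjacency G w (tail G e) (head G e) = edge_weight G w e"
    "adjacency G w (head G e) (tail G e) = cnj (edge_weight G w e)"
    using no_opposite_arcs by (auto simp: adjacency_def edge_weight_def)
qed

lemma adjacency_eq_0: "(i, j) \<notin> links G (arcs G) \<Longrightarrow> adjacency G w i j = 0"
  by (auto simp: adjacency_def links_def arcs_ends_conv)

lemma tail_component_restrict:
  assumes "E \<subseteq> arcs G" "e \<in> E"
  shows "tail_component (G\<lparr>arcs := E\<rparr>) e = tail_side G E e"
    and "head_component (G\<lparr>arcs := E\<rparr>) e = head_side G E e"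
proof -
  have del: "pre_digraph.del_arc (G\<lparr>arcs := E\<rparr>) e = G\<lparr>arcs := E - {e}\<rparr>"
    by (simp add: pre_digraph.del_arc_def)
  interpret D: oriented_graph "G\<lparr>arcs := E - {e}\<rparr>"
    using assms by (intro oriented_graph_restrict) auto
  have "tail G e \<in> verts G" "head G e \<in> verts G"
    using assms by auto
  then show "tail_component (G\<lparr>arcs := E\<rparr>) e = tail_side G E e"
    "head_component (G\<lparr>arcs := E\<rparr>) e = head_side G E e"
    using D.reachable_underlying_iff
    by (auto simp: tail_component_def head_component_def component_def del tail_side_def head_side_def)
qed

end

locale gauged_weights = gauged_graph +
  fixes w :: "'a \<Rightarrow> 'a \<Rightarrow> complex"
  assumes weight_nonzero: "e \<in> arcs G \<Longrightarrow> edge_weight G w e \<noteq> 0"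
    and weight_not_neg: "e \<in> arcs G \<Longrightarrow> edge_weight G w e \<notin> neg_reals"
    and gauge: "(i, j) \<in> links G (arcs G) \<Longrightarrow>
      - adjacency G w i j = of_real (cmod (adjacency G w i j)) * (z i * cnj (z j))"
    and c_eq: "e \<in> arcs G \<Longrightarrow> c e = csqrt (edge_weight G w e) * cnj (z (tail G e))"
begin

lemma csqrt_tail: "e \<in> arcs G \<Longrightarrow> csqrt (edge_weight G w e) = c e * z (tail G e)"
  using z_cnj(2)[of "tail G e"] by (simp add: c_eq mult.assoc)

text \<open>For an arc from \<open>t\<close> to \<open>h\<close> with root \<open>s\<close> of its
  weight, the gauge reads \<open>- s * s = s * cnj s * z t * cnj (z h)\<close>. Cancelling
  \<open>s\<close> and moving the unit factors over gives
  \<open>cnj s = - s * cnj (z t) * z h\<close>. The minus sign at heads thus comes from gauging the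
  negated adjacency matrix.\<close>

lemma csqrt_head:
  assumes e: "e \<in> arcs G"
  shows "csqrt (cnj (edge_weight G w e)) = - (c e * z (head G e))"
proof -
  define s where "s = csqrt (edge_weight G w e)"
  have s0: "s \<noteq> 0"
    using weight_nonzero[OF e] by (simp add: s_def)
  have "s * s = edge_weight G w e"
    by (simp add: s_def power2_eq_square[symmetric])
  moreover have "- edge_weight G w e = of_real (cmod (edge_weight G w e)) * (z (tail G e) * cnj (z (head G e)))"
    using gauge[OF links_arc[OF e]] by (simp add: adjacency_arc[OF e])
  moreover have "of_real (cmod (edge_weight G w e)) = s * cnj s"
    by (simp add: s_def complex_norm_square[symmetric] flip: of_real_power)
  ultimately have "s * (- s) = s * (cnj s * (z (tail G e) * cnj (z (head G e))))"
    by (simp add: mult.assoc)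
  then have "- s = cnj s * (z (tail G e) * cnj (z (head G e)))"
    using s0 by (simp only: mult_cancel_left) simp
  then have "- (s * cnj (z (tail G e)) * z (head G e)) =
      cnj s * (z (tail G e) * cnj (z (tail G e))) * (z (head G e) * cnj (z (head G e)))"
    by (simp add: mult_ac flip: mult_minus_left)
  then show ?thesis
    using z_cnj(1) e weight_not_neg[OF e] by (simp add: c_eq s_def csqrt_cnj)
qed

lemma incidence_eq:
  "e \<in> arcs G \<Longrightarrow> signless_incidence G w i e = gauged_incidence G z c i e"
  using tail_neq_head[of e] by (auto simp: signless_incidence_def gauged_incidence_def
      incidence_sign_def csqrt_tail csqrt_head mult.commute)

text \<open>At most one arc joins \<open>i\<close> and \<open>j\<close>. Its entries are a root
  \<open>s\<close> of the weight at the tail and \<open>cnj s\<close> at the head, so one times the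
  conjugate of the other is a square: the weight or its conjugate.\<close>

lemma incidence_gram_offdiag:
  assumes "i \<noteq> j"
  shows "(\<Sum>e\<in>arcs G. signless_incidence G w i e * cnj (signless_incidence G w j e)) = adjacency G w i j"
proof (cases "(i, j) \<in> links G (arcs G)")
  case True
  then obtain e where e: "e \<in> arcs G" and ij: "i = tail G e \<and> j = head G e \<or> i = head G e \<and> j = tail G e"
    by (rule linksE)
  have "(\<Sum>f\<in>arcs G. signless_incidence G w i f * cnj (signless_incidence G w j f)) =
      (\<Sum>f\<in>{e}. signless_incidence G w i f * cnj (signless_incidence G w j f))"
  proof (rule sum.mono_neutral_right)
    show "\<forall>f\<in>arcs G - {e}. signless_incidence G w i f * cnj (signless_incidence G w j f) = 0"
    proof
      fix f assume f: "f \<in> arcs G - {e}"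
      then have "\<not> (i = tail G f \<and> j = head G f \<or> i = head G f \<and> j = tail G f)"
        using arcs_eqI[OF e, of f] ij by auto
      then show "signless_incidence G w i f * cnj (signless_incidence G w j f) = 0"
        using assms by (auto simp: signless_incidence_def)
    qed
  qed (use e in auto)
  also have "\<dots> = signless_incidence G w i e * cnj (signless_incidence G w j e)"
    by simp
  also have "\<dots> = adjacency G w i j"
  proof -
    have sq: "csqrt (edge_weight G w e) * csqrt (edge_weight G w e) = edge_weight G w e"
      by (simp add: power2_eq_square[symmetric])
    then have "cnj (csqrt (edge_weight G w e)) * cnj (csqrt (edge_weight G w e)) = cnj (edge_weight G w e)"
      by (metis complex_cnj_mult)
    then show ?thesis
      using ij sq tail_neq_head[OF e] weight_not_neg[OF e]
      by (auto simp: signless_incidence_def adjacency_arc[OF e] csqrt_cnj)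
  qed
  finally show ?thesis .
next
  case False
  then have "signless_incidence G w i e * cnj (signless_incidence G w j e) = 0" if "e \<in> arcs G" for e
    using that assms by (auto simp: signless_incidence_def links_def)
  then show ?thesis
    unfolding adjacency_eq_0[OF False] by (rule sum.neutral[rule_format])
qed

text \<open>The rows of \<open>N N* Z\<close> sum to 0, so the off-diagonal entries determine the diagonal ones.\<close>

lemma laplacian_eq_gram:
  "mat_eq_on (verts G) (verts G) (signless_laplacian G w)
    (mat_mult (arcs G) (gauged_incidence G z c) (conj_transpose (gauged_incidence G z c)))"
proof (unfold mat_eq_on_def, intro ballI)
  fix i j assume i: "i \<in> verts G" and j: "j \<in> verts G"
  let ?M = "mat_mult (arcs G) (gauged_incidence G z c) (conj_transpose (gauged_incidence G z c))"
  have off: "?M i l = adjacency G w i l" if "i \<noteq> l" for l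
    using incidence_gram_offdiag[OF that]
    by (simp add: mat_mult_def conj_transpose_def incidence_eq cong: sum.cong)
  have loop: "adjacency G w i i = 0"
    by (rule adjacency_eq_0[OF links_irrefl])
  show "signless_laplacian G w i j = ?M i j"
  proof (cases "i = j")
    case False
    then show ?thesis
      using off by (simp add: signless_laplacian_def)
  next
    case True
    have "(\<Sum>l\<in>verts G. ?M i l * z l) =
        (\<Sum>e\<in>arcs G. gauged_incidence G z c i e * (\<Sum>l\<in>verts G. cnj (gauged_incidence G z c l e) * z l))"
      unfolding mat_mult_def conj_transpose_def sum_distrib_left sum_distrib_right
      by (subst sum.swap) (simp add: mult.assoc)
    also have "\<dots> = 0"
    proof (intro sum.neutral ballI)
      fix e assume e: "e \<in> arcs G"
      have "(\<Sum>l\<in>verts G. cnj (gauged_incidence G z c l e) * z l) =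
          (\<Sum>l\<in>verts G. cnj (c e) * incidence_sign G l e)"
      proof (rule sum.cong)
        fix l assume "l \<in> verts G"
        have "cnj (gauged_incidence G z c l e) * z l = (cnj (z l) * z l) * (cnj (c e) * incidence_sign G l e)"
          by (simp add: gauged_incidence_def incidence_sign_def)
        then show "cnj (gauged_incidence G z c l e) * z l = cnj (c e) * incidence_sign G l e"
          using z_cnj(2)[OF \<open>l \<in> verts G\<close>] by simp
      qed simp
      then show "gauged_incidence G z c i e * (\<Sum>l\<in>verts G. cnj (gauged_incidence G z c l e) * z l) = 0"
        by (simp add: sum_incidence_sign[OF e])
    qed
    finally have "?M i i * z i + (\<Sum>l\<in>verts G - {i}. ?M i l * z l) = 0"
      using i by (simp add: sum.remove)
    then have "?M i i * z i = - (\<Sum>l\<in>verts G - {i}. ?M i l * z l)"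
      by (simp add: add_eq_0_iff)
    \<comment> \<open>The gauge turns each term \<open>- a i l * z l\<close> into
      \<open>|a i l| * z i\<close>, since \<open>cnj (z l) * z l = 1\<close>; cancelling
      \<open>z i\<close> then leaves the absolute row sum.\<close>
    also have "\<dots> = (\<Sum>l\<in>verts G - {i}. of_real (cmod (adjacency G w i l)) * z i)"
      unfolding sum_negf[symmetric]
    proof (rule sum.cong)
      fix l assume l: "l \<in> verts G - {i}"
      have M: "?M i l = adjacency G w i l"
        using l by (intro off) auto
      show "- (?M i l * z l) = of_real (cmod (adjacency G w i l)) * z i"
      proof (cases "(i, l) \<in> links G (arcs G)")
        case True
        have "- (?M i l * z l) = of_real (cmod (adjacency G w i l)) * z i * (cnj (z l) * z l)"
          unfolding M using gauge[OF True] by (simp add: mult.assoc flip: mult_minus_left)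
        then show ?thesis
          using z_cnj(2)[of l] l by simp
      next
        case False
        then show ?thesis
          unfolding M adjacency_eq_0[OF False] by simp
      qed
    qed simp
    also have "\<dots> = of_real (\<Sum>l\<in>verts G - {i}. cmod (adjacency G w i l)) * z i"
      by (simp add: sum_distrib_right)
    finally have "?M i i = of_real (\<Sum>l\<in>verts G - {i}. cmod (adjacency G w i l))"
      using z_unit[OF i] by (auto simp del: of_real_sum)
    then show ?thesis
      using True loop by (simp add: signless_laplacian_def)
  qed
qed

lemma incidence_pinv_eq:
  assumes E: "E \<in> tree_arcs G" and "e \<in> E" "j \<in> verts G"
  shows "incidence_pinv (G\<lparr>arcs := E\<rparr>) w e j = tree_pinv G z c E e j"
proof -
  have "signless_incidence (G\<lparr>arcs := E\<rparr>) w = signless_incidence G w"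
    by (simp add: fun_eq_iff signless_incidence_def edge_weight_def)
  then have "mat_eq_on (verts G) E (signless_incidence (G\<lparr>arcs := E\<rparr>) w) (gauged_incidence G z c)"
    using tree_arcs_subset[OF E] incidence_eq by (auto simp: mat_eq_on_def)
  then have "is_mp_inverse (verts G) E (signless_incidence (G\<lparr>arcs := E\<rparr>) w) (tree_pinv G z c E)"
    by (rule is_mp_inverse_cong_matrix[OF tree_pinv_is_mp_inverse[OF E]])
  from mp_inverse_eqI[OF this \<open>e \<in> E\<close> \<open>j \<in> verts G\<close>] show ?thesis
    by (simp add: incidence_pinv_def)
qed

lemma laplacian_pinv_eq:
  assumes "i \<in> verts G" "j \<in> verts G"
  shows "laplacian_pinv G w i j = (\<Sum>e\<in>arcs G. cnj (average_pinv G z c e i) * average_pinv G z c e j)"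
  using mp_inverse_eqI[OF is_mp_inverse_cong_matrix[OF average_pinv_gram laplacian_eq_gram] assms]
  by (simp add: laplacian_pinv_def mat_mult_def conj_transpose_def)

lemma tree_weight_eq:
  assumes "E \<subseteq> arcs G"
  shows "cmod (weight_prod (G\<lparr>arcs := E\<rparr>) w) = tree_weight c E"
proof -
  have "cmod (edge_weight G w e) = (cmod (c e))\<^sup>2" if "e \<in> E" for e
    using that assms z_unit[of "tail G e"] by (auto simp: c_eq norm_mult)
  then show ?thesis
    by (simp add: weight_prod_def tree_weight_def edge_weight_def prod_norm[symmetric])
qed

text \<open>Each step contributes one minus sign, as the gauge is for the negated entries, and a
  unit phase is inverted by conjugation. In \<open>tree_pinv_formula\<close> the resulting sign
  cancels against the power of -1 given by the distance.\<close>

lemma walk_weight_gauge: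
  assumes "vwalk p (underlying G)"
  shows "of_real (cmod (walk_weight G w p)) / walk_weight G w p =
    (-1) ^ vwalk_length p * (cnj (z (hd p)) * z (last p))"
proof -
  let ?a = "\<lambda>i j. - adjacency G w i j"
  have p: "set p \<subseteq> verts G" "set (vwalk_arcs p) \<subseteq> links G (arcs G)" "p \<noteq> []"
    using assms by (auto simp: vwalk_underlying_iff)
  have "?a i j \<noteq> 0" if "(i, j) \<in> links G (arcs G)" for i j
    using that weight_nonzero by (auto elim!: linksE simp: adjacency_arc)
  then have nz: "walk_prod ?a p \<noteq> 0"
    using p(2) unfolding walk_prod_def by (auto simp: prod_list_zero_iff)
  have sign: "walk_weight G w p = (-1) ^ vwalk_length p * walk_prod ?a p"
    by (simp add: walk_prod_uminus walk_weight_eq power_mult_distrib[symmetric] flip: mult.assoc)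
  have "walk_prod ?a p = of_real (cmod (walk_prod ?a p)) * (z (hd p) * cnj (z (last p)))"
    by (rule walk_prod_gauge) (use p gauge z_unit in auto)
  moreover have "z (hd p) * cnj (z (last p)) * (cnj (z (hd p)) * z (last p)) = 1"
  proof -
    have "z (hd p) * cnj (z (last p)) * (cnj (z (hd p)) * z (last p)) =
        (z (hd p) * cnj (z (hd p))) * (z (last p) * cnj (z (last p)))"
      by (simp only: mult_ac)
    moreover have "hd p \<in> verts G" "last p \<in> verts G"
      using p(1,3) by auto
    ultimately show ?thesis
      by (simp only: z_cnj(1) mult_1)
  qed
  ultimately have "walk_prod ?a p * (cnj (z (hd p)) * z (last p)) = of_real (cmod (walk_prod ?a p))"
    by (metis mult.assoc mult.right_neutral)
  then have "cnj (z (hd p)) * z (last p) = of_real (cmod (walk_prod ?a p)) / walk_prod ?a p"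
    using nz by (simp add: field_simps)
  then show ?thesis
    unfolding sign by (cases "even (vwalk_length p)") (simp_all add: norm_mult del: vwalk_length_simp)
qed

text \<open>For the end \<open>u\<close> of \<open>k\<close> on the side of \<open>j\<close>, the
  sign and the walk factor combine to \<open>cnj (z j) * z u\<close>. The root in the denominator is
  \<open>c k * z u\<close> at the tail and \<open>- (c k * z u)\<close> at the head. The quotient is
  therefore \<open>cnj (z j) / c k\<close> up to sign, and the minus sign on the head side is the
  one in \<open>tree_gap\<close>.\<close>

lemma tree_pinv_formula:
  assumes E: "E \<in> tree_arcs G" and k: "k \<in> E" and j: "j \<in> verts G"
  defines "T \<equiv> G\<lparr>arcs := E\<rparr>"
  shows "tree_pinv G z c E k j =
    (-1) ^ edge_dist T k j / of_nat (card (verts G)) *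
    (if j \<in> tail_component T k
     then of_nat (card (head_component T k)) / csqrt (edge_weight T w k) *
          (let \<gamma> = tree_path T j (tail T k)
           in complex_of_real (cmod (walk_weight G w \<gamma>)) / walk_weight G w \<gamma>)
     else of_nat (card (tail_component T k)) / csqrt (cnj (edge_weight T w k)) *
          (let \<gamma> = tree_path T j (head T k)
           in complex_of_real (cmod (walk_weight G w \<gamma>)) / walk_weight G w \<gamma>))"
proof -
  have sub: "E \<subseteq> arcs G" and kG: "k \<in> arcs G"
    using tree_arcs_subset[OF E] k by auto
  then have ends: "tail G k \<in> verts G" "head G k \<in> verts G"
    by auto
  have T: "verts T = verts G" "arcs T = E" "tail T = tail G" "head T = head G" "links T = links G"
    by (simp_all add: T_def)
  have sides: "tail_side T E k = tail_side G E k" "head_side T E k = head_side G E k"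
    by (simp_all add: tail_side_def head_side_def T)
  interpret H: oriented_graph T
    unfolding T_def by (rule oriented_graph_restrict[OF sub])
  have tree: "all_bridges T" "connected T"
    using E tree_arcs_iff[of E] j by (auto simp: T_def)
  have comp: "tail_component T k = tail_side G E k" "head_component T k = head_side G E k"
    unfolding T_def by (rule tail_component_restrict[OF sub k])+
  have ew: "edge_weight T w k = edge_weight G w k"
    by (simp add: edge_weight_def T)
  have phase: "(-1) ^ graph_dist T u j * (of_real (cmod (walk_weight G w (tree_path T j u))) /
      walk_weight G w (tree_path T j u)) = cnj (z j) * z u" if u: "u \<in> verts G" for u
  proof -
    have path: "vpath (tree_path T j u) (underlying T)" "hd (tree_path T j u) = j" "last (tree_path T j u) = u"
      using H.tree_path_props[OF tree] j u by (simp_all add: T)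
    have "vwalk (tree_path T j u) (underlying G)"
      using path(1) links_mono[OF sub, of G] by (auto simp: vpath_def vwalk_underlying_iff T)
    note walk_weight_gauge[OF this, unfolded path(2,3)]
    moreover have "(-1) ^ graph_dist T u j = (-1 :: complex) ^ vwalk_length (tree_path T j u)"
      using H.graph_dist_parity[OF tree, of u j] u j
      by (auto simp: T minus_one_power_iff simp del: vwalk_length_simp)
    ultimately show ?thesis
      by (simp add: power_mult_distrib[symmetric] del: vwalk_length_simp flip: mult.assoc)
  qed
  have rearrange: "a / b * (h / s * p) = h / b * ((a * p) / s)" for a b h s p :: complex
    by simp
  show ?thesis
  proof (cases "j \<in> tail_side G E k")
    case True
    have dist: "edge_dist T k j = graph_dist T (tail G k) j"
      using H.edge_dist_eq(1)[OF tree, of k j] True k j by (simp add: T sides)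
    have "cnj (z j) * z (tail G k) / csqrt (edge_weight G w k) = cnj (z j) / c k"
      using z_unit[OF ends(1)] by (auto simp: csqrt_tail[OF kG])
    then show ?thesis
      unfolding comp T ew Let_def if_P[OF True] rearrange dist phase[OF ends(1)]
      by (simp add: tree_pinv_def tree_gap_def True)
  next
    case False
    then have "j \<in> head_side G E k"
      using sides_cover[OF E k] j by blast
    then have dist: "edge_dist T k j = graph_dist T (head G k) j"
      using H.edge_dist_eq(2)[OF tree, of k j] k j by (simp add: T sides)
    have "cnj (z j) * z (head G k) / csqrt (cnj (edge_weight G w k)) = - (cnj (z j) / c k)"
      using z_unit[OF ends(2)] by (auto simp: csqrt_head[OF kG])
    then show ?thesis
      unfolding comp T ew Let_def if_not_P[OF False] rearrange dist phase[OF ends(2)]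
      by (simp add: tree_pinv_def tree_gap_def False)
  qed
qed

end

theorem theorem5p2:
  fixes G :: "(nat, nat) pre_digraph" and w :: "nat \<Rightarrow> nat \<Rightarrow> complex" and n m :: nat
  assumes "oriented_graph G"
    and "verts G = {1..n}" and "n \<ge> 2"
    and "arcs G = {1..m}" and "m \<ge> 1"
    and "connected G"
    and "\<And>e. e \<in> arcs G \<Longrightarrow> edge_weight G w e \<noteq> 0"
    and "\<And>e. e \<in> arcs G \<Longrightarrow> edge_weight G w e \<notin> neg_reals"
    and "\<exists>c. is_cycle G c"
    and "\<And>c. is_cycle G c \<Longrightarrow> odd (vwalk_length c) \<Longrightarrow> walk_weight G w c \<in> neg_reals"
    and "\<And>c. is_cycle G c \<Longrightarrow> even (vwalk_length c) \<Longrightarrow> walk_weight G w c \<in> pos_reals"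
  shows "(\<forall>i\<in>{1..n}. \<forall>j\<in>{1..n}.
            laplacian_pinv G w i j =
              complex_of_real ((1 / (\<Sum>T\<in>spanning_trees G. cmod (weight_prod T w)))\<^sup>2) *
              (\<Sum>k=1..m. \<Sum>(Tr, Ts)\<in>{(Tr, Ts). Tr \<in> spanning_trees G \<and> Ts \<in> spanning_trees G \<and>
                                               k \<in> arcs Tr \<inter> arcs Ts}.
                 complex_of_real (cmod (weight_prod Tr w)) *
                 complex_of_real (cmod (weight_prod Ts w)) *
                 cnj (incidence_pinv Tr w k i) * incidence_pinv Ts w k j))
       \<and> (\<forall>T\<in>spanning_trees G. \<forall>k\<in>arcs T. \<forall>j\<in>{1..n}.
            incidence_pinv T w k j =
              (-1) ^ edge_dist T k j / of_nat n *
              (if j \<in> tail_component T k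
               then of_nat (card (head_component T k)) / csqrt (edge_weight T w k) *
                    (let \<gamma> = tree_path T j (tail T k)
                     in complex_of_real (cmod (walk_weight G w \<gamma>)) / walk_weight G w \<gamma>)
               else of_nat (card (tail_component T k)) / csqrt (cnj (edge_weight T w k)) *
                    (let \<gamma> = tree_path T j (head T k)
                     in complex_of_real (cmod (walk_weight G w \<gamma>)) / walk_weight G w \<gamma>)))"
proof -
  interpret oriented_graph G by fact
  let ?a = "\<lambda>i j. - adjacency G w i j"
  have herm: "?a j i = cnj (?a i j)" if "(i, j) \<in> links G (arcs G)" for i j
    using that by (auto elim!: linksE simp: adjacency_arc)
  have nz: "?a i j \<noteq> 0" if "(i, j) \<in> links G (arcs G)" for i j
    using that assms(7) by (auto elim!: linksE simp: adjacency_arc)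
  have cyc: "walk_prod ?a c \<in> pos_reals" if "is_cycle G c" for c
  proof (cases "even (vwalk_length c)")
    case True
    then show ?thesis
      using assms(11)[OF that] by (simp add: walk_prod_uminus walk_weight_eq del: vwalk_length_simp)
  next
    case False
    then show ?thesis
      using assms(10)[OF that]
      by (simp add: walk_prod_uminus walk_weight_eq pos_reals_iff neg_reals_iff del: vwalk_length_simp)
  qed
  obtain z where z: "\<And>i. i \<in> verts G \<Longrightarrow> cmod (z i) = 1"
    and gauge: "\<And>i j. (i, j) \<in> links G (arcs G) \<Longrightarrow> ?a i j = of_real (cmod (?a i j)) * (z i * cnj (z j))"
    using gauge_exists[OF \<open>connected G\<close>, of ?a] herm nz cyc by blast
  define c where "c e = csqrt (edge_weight G w e) * cnj (z (tail G e))" for e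
  have z_nz: "z (tail G e) \<noteq> 0" if "e \<in> arcs G" for e
    using z[of "tail G e"] that by auto
  interpret gauged_weights G z c w
    by unfold_locales (use assms(6-8) z z_nz gauge in \<open>auto simp: c_def\<close>)
  let ?T = "\<lambda>E. G\<lparr>arcs := E\<rparr>"
  let ?S = "\<Sum>E\<in>tree_arcs G. tree_weight c E"
  have ne: "verts G \<noteq> {}" and card: "card (verts G) = n"
    using assms(2,3) by auto
  have ST: "spanning_trees G = ?T ` tree_arcs G"
    by (rule spanning_trees_eq[OF ne])
  have total: "(\<Sum>T\<in>spanning_trees G. cmod (weight_prod T w)) = ?S"
    unfolding ST sum.reindex[OF inj_restrict_arcs] o_def
    by (intro sum.cong) (auto simp: tree_weight_eq tree_arcs_subset)
  have avg: "(\<Sum>T | T \<in> spanning_trees G \<and> k \<in> arcs T.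
        of_real (cmod (weight_prod T w)) * incidence_pinv T w k j) = of_real ?S * average_pinv G z c k j"
    if "j \<in> verts G" for k j
  proof -
    have eq: "{T \<in> spanning_trees G. k \<in> arcs T} = ?T ` {E \<in> tree_arcs G. k \<in> E}"
      by (auto simp: ST)
    have "(\<Sum>T | T \<in> spanning_trees G \<and> k \<in> arcs T.
        of_real (cmod (weight_prod T w)) * incidence_pinv T w k j) =
        (\<Sum>E | E \<in> tree_arcs G \<and> k \<in> E. of_real (tree_weight c E) * tree_pinv G z c E k j)"
      unfolding eq sum.reindex[OF inj_restrict_arcs] o_def
      using that by (intro sum.cong) (auto simp: tree_weight_eq tree_arcs_subset incidence_pinv_eq)
    then show ?thesis
      using total_tree_weight_pos by (simp add: average_pinv_def del: of_real_sum)
  qed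
  \<comment> \<open>The pairs form a product set, so for each \<open>k\<close> the double sum
    factors into a conjugated and a plain weighted sum over the trees through
    \<open>k\<close>.\<close>
  have pairs: "(\<Sum>(Tr, Ts)\<in>{(Tr, Ts). Tr \<in> spanning_trees G \<and> Ts \<in> spanning_trees G \<and>
          k \<in> arcs Tr \<inter> arcs Ts}.
        complex_of_real (cmod (weight_prod Tr w)) * complex_of_real (cmod (weight_prod Ts w)) *
        cnj (incidence_pinv Tr w k i) * incidence_pinv Ts w k j) =
      of_real (?S\<^sup>2) * (cnj (average_pinv G z c k i) * average_pinv G z c k j)"
    if "i \<in> verts G" "j \<in> verts G" for k i j
  proof -
    let ?B = "{T \<in> spanning_trees G. k \<in> arcs T}"
    let ?f = "\<lambda>T i. of_real (cmod (weight_prod T w)) * incidence_pinv T w k i"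
    have prod: "{(Tr, Ts). Tr \<in> spanning_trees G \<and> Ts \<in> spanning_trees G \<and> k \<in> arcs Tr \<inter> arcs Ts} =
        ?B \<times> ?B"
      by auto
    have "(\<Sum>(Tr, Ts)\<in>?B \<times> ?B.
        complex_of_real (cmod (weight_prod Tr w)) * complex_of_real (cmod (weight_prod Ts w)) *
        cnj (incidence_pinv Tr w k i) * incidence_pinv Ts w k j) =
        (\<Sum>(Tr, Ts)\<in>?B \<times> ?B. cnj (?f Tr i) * ?f Ts j)"
      by (intro sum.cong) (auto simp: mult_ac)
    also have "\<dots> = cnj (\<Sum>T\<in>?B. ?f T i) * (\<Sum>T\<in>?B. ?f T j)"
      unfolding cnj_sum by (simp only: sum.cartesian_product[symmetric] sum_product)
    also have "\<dots> = of_real (?S\<^sup>2) * (cnj (average_pinv G z c k i) * average_pinv G z c k j)"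
      unfolding avg[OF that(1)] avg[OF that(2)] by (simp add: power2_eq_square del: of_real_sum)
    finally show ?thesis
      unfolding prod .
  qed
  show ?thesis
  proof (intro conjI ballI)
    fix i j assume "i \<in> {1..n}" "j \<in> {1..n}"
    then have ij: "i \<in> verts G" "j \<in> verts G"
      by (simp_all add: assms(2))
    \<comment> \<open>Each of the two averages is already normalised by \<open>?S\<close>, so the
      squared factor in front only removes the square that \<open>pairs\<close> brings in.\<close>
    have "of_real ((1 / ?S)\<^sup>2) * (of_real (?S\<^sup>2) * x) = x" for x :: complex
      using total_tree_weight_pos
      by (simp add: power_divide del: of_real_sum of_real_power flip: of_real_mult mult.assoc)
    then show "laplacian_pinv G w i j =
        complex_of_real ((1 / (\<Sum>T\<in>spanning_trees G. cmod (weight_prod T w)))\<^sup>2) *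
        (\<Sum>k=1..m. \<Sum>(Tr, Ts)\<in>{(Tr, Ts). Tr \<in> spanning_trees G \<and> Ts \<in> spanning_trees G \<and>
                                         k \<in> arcs Tr \<inter> arcs Ts}.
           complex_of_real (cmod (weight_prod Tr w)) *
           complex_of_real (cmod (weight_prod Ts w)) *
           cnj (incidence_pinv Tr w k i) * incidence_pinv Ts w k j)"
      unfolding total pairs[OF ij] sum_distrib_left[symmetric] laplacian_pinv_eq[OF ij] assms(4)
      by simp
  next
    fix T k j assume "T \<in> spanning_trees G" "k \<in> arcs T" "j \<in> {1..n}"
    then obtain E where E: "E \<in> tree_arcs G" "T = ?T E" "k \<in> E" and j: "j \<in> verts G"
      by (auto simp: ST assms(2))
    show "incidence_pinv T w k j =
        (-1) ^ edge_dist T k j / of_nat n *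
        (if j \<in> tail_component T k
         then of_nat (card (head_component T k)) / csqrt (edge_weight T w k) *
              (let \<gamma> = tree_path T j (tail T k)
               in complex_of_real (cmod (walk_weight G w \<gamma>)) / walk_weight G w \<gamma>)
         else of_nat (card (tail_component T k)) / csqrt (cnj (edge_weight T w k)) *
              (let \<gamma> = tree_path T j (head T k)
               in complex_of_real (cmod (walk_weight G w \<gamma>)) / walk_weight G w \<gamma>))"
      using tree_pinv_formula[OF E(1,3) j] incidence_pinv_eq[OF E(1,3) j]
      unfolding E(2) card by (rule trans[rotated])
  qed
qed

end
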